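(* Assume that a Schrödinger L-system $\Theta_{\mu,h}$ with a main operator $T_h$ has c-entropy $\mathcal S$. Then, under the constraint that $T_h$ is $\beta$-sectorial, the L-system $\Theta_{\mu,h}$ has the minimum coefficient of dissipation $$\mathcal D_{min}=\sin^2\beta\left[B\coth\mathcal S-E\cot\beta-\sqrt{(E\cot\beta-B\coth\mathcal S)^2-D}\,\right],$$ where $A=\operatorname{Re}m_\infty(i)$, $B=-\operatorname{Im}m_\infty(i)$, $D=E^2+B^2$, $E=A-m$, and $m=m_\infty(-0)$. In this case, the L-system $\Theta_{\mu,h}$ is determined by the parameters $$h=(\cot\beta)\mathcal D_{min}-m+i\mathcal D_{min}\quad\text{and (arbitrary)}\quad\mu\in\mathbb R\cup\{\infty\}.$$
   Context: Setting. Let $\ell\in\mathbb R$, let $q$ be a real locally summable function on $[\ell,+\infty)$, $l(y)=-y''+q(x)y$, $\mathcal H=L_2(\ell,+\infty)$. Let $D^*$ be the set of $y\in\mathcal H$ that are locally absolutely continuous together with $y'$ and satisfy $l(y)\in\mathcal H$. The minimal symmetric operator $\dot A y=l(y)$ with boundary conditions $y(\ell)=y'(\ell)=0$ is assumed to have deficiency indices $(1,1)$; $\operatorname{Dom}(\dot A^* )=D^*$, $\dot A^*y=l(y)$. For $h\in\mathbb C$ with $\operatorname{Im}h>0$, $T_h y=l(y)$ with domain $\{y\in D^*: y'(\ell)=hy(\ell)\}$. Weyl function. Let $\varphi_1,\varphi_2$ solve $l(\varphi_k)=\lambda\varphi_k$ with $\varphi_1(\ell,\lambda)=0,\ \varphi_1'(\ell,\lambda)=1$,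 $\varphi_2(\ell,\lambda)=-1,\ \varphi_2'(\ell,\lambda)=0$. The Weyl function $m_\infty(\lambda)$ is such that $\varphi_2(\cdot,\lambda)+m_\infty(\lambda)\varphi_1(\cdot,\lambda)\in L_2(\ell,+\infty)$. One has $\operatorname{Im}m_\infty(i)<0$. Standing assumptions: $\dot A$ is nonnegative, i.e. $(\dot Af,f)\ge0$ for $f\in\operatorname{Dom}(\dot A)$, and $m_\infty(-0):=\lim_{\lambda\to0,\lambda<0}m_\infty(\lambda)<\infty$. Schrödinger L-systems. $\mathcal H_+=D^*$ with $(y,z)_+=(y,z)+(\dot A^*y,\dot A^*z)$, and $\mathcal H_+\subset\mathcal H\subset\mathcal H_-$ is the corresponding rigged triplet; $\delta(x-\ell),\delta'(x-\ell)\in\mathcal H_-$ act by $(y,\delta)=y(\ell)$, $(y,\delta')=-y'(\ell)$. For $\mu\in\mathbb R\cup\{\infty\}$ put $\mathbb A_{\mu,h}y=-y''+q y-\frac1{\mu-h}[y'(\ell)-hy(\ell)][\mu\delta(x-\ell)+\delta'(x-\ell)]$ and $g=\frac{(\operatorname{Im}h)^{1/2}}{|\mu-h|}[\mu\delta(x-\ell)+\delta'(x-\ell)]$ (limits as $\mu\to\infty$ if $\mu=\infty$), $Kc=cg$ for $c\in\mathbb C$; then $\operatorname{Im}\mathbb A_{\mu,h}=KK^*$. The array $\Theta_{\mu,h}=(\mathbb A_{\mu,h},K,1;\ \mathcal H_+\subset\mathcal H\subset\mathcal H_-,\mathbb C)$ is the Schrödinger L-system with main operator $T_h$ and state-space operator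 $\mathbb A_{\mu,h}$. Its transfer function is $W_{\Theta_{\mu,h}}(z)=I-2iK^*(\mathbb A_{\mu,h}-zI)^{-1}K=\frac{\mu-h}{\mu-\bar h}\cdot\frac{m_\infty(z)+\bar h}{m_\infty(z)+h}$ (limit as $\mu\to\infty$ if $\mu=\infty$). The coefficient of dissipation of $\Theta_{\mu,h}$ (and of $T_h$) is $\mathcal D=\operatorname{Im}h$. The c-entropy of $\Theta_{\mu,h}$ is $\mathcal S=-\ln|W_{\Theta_{\mu,h}}(-i)|$; it equals $-\ln|\kappa|$ where $|\kappa|=\left|\frac{m_\infty(i)+h}{m_\infty(i)+\bar h}\right|<1$ is the modulus of von Neumann's parameter of $T_h$, i.e. of the number $\kappa$ with $g_+-\kappa g_-\in\operatorname{Dom}(T_h)$ for some $g_\pm\in\operatorname{Ker}(\dot A^*\mp iI)$, $\|g_\pm\|=1$. The theorem addresses the problem of describing the L-systems with Schrödinger operator that have a given c-entropy and minimal dissipation coefficient, here within the class of Schrödinger L-systems with $\beta$-sectorial main operator. Sectoriality. A linear operator $T$ is accretive if $\operatorname{Re}(Tf,f)\ge0$ for all $f\in\operatorname{Dom}(T)$. An accretive $T$ is called $\beta$-sectorial, $\beta\in(0,\pi/2)$, if $(\cot\beta)|\operatorname{Im}(Tf,f)|\le\operatorname{Re}(Tf,f)$ for all $f\in\operatorname{Dom}(T)$, and throughout $\beta$ is the exact angle of sectoriality: $\tan\beta=\sup_{f\in\operatorname{Dom}(T)}\frac{|\operatorname{Im}(Tf,f)|}{\operatorname{Re}(Tf,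f)}$.
   Formalization: The printed formula for D_min is false for every β in (0,π/2): under the square root, D must be replaced by D/sin²β (for example q=0, ℓ=0, β=π/4, S the c-entropy of h=1+i: the true minimum is 1/2, the printed value about 0.191); the corrected formula is proved. *)

theory Defs
  imports "HOL-Analysis.Analysis"
begin

section \<open>The Hilbert space and the differential expression\<close>

text \<open>
  A function on the half-line is represented by a total function \<open>real \<Rightarrow> complex\<close>; only its
  values on \<open>{l..}\<close> matter. Inner products are linear in the first argument.
\<close>

definition L2 :: "real \<Rightarrow> (real \<Rightarrow> complex) set" where
  "L2 l = {f. f \<in> borel_measurable (lebesgue_on {l..}) \<and>
              integrable (lebesgue_on {l..}) (\<lambda>x. (cmod (f x))\<^sup>2)}"

definition inner_L2 :: "real \<Rightarrow> (real \<Rightarrow> complex) \<Rightarrow> (real \<Rightarrow> complex) \<Rightarrow> complex" where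
  "inner_L2 l f g = (LINT x|lebesgue_on {l..}. f x * cnj (g x))"

definition locally_summable :: "real \<Rightarrow> (real \<Rightarrow> real) \<Rightarrow> bool" where
  "locally_summable l q \<longleftrightarrow> (\<forall>b\<ge>l. integrable (lebesgue_on {l..b}) q)"

text \<open>
  Local absolute continuity on \<open>{l..}\<close> in the form given by the Lebesgue fundamental theorem of
  calculus: \<open>f\<close> is locally absolutely continuous iff it is the indefinite integral of a locally
  summable \<open>w\<close>, and then \<open>w\<close> is its derivative almost everywhere.
\<close>

definition loc_abs_cont_with :: "real \<Rightarrow> (real \<Rightarrow> complex) \<Rightarrow> (real \<Rightarrow> complex) \<Rightarrow> bool" where
  "loc_abs_cont_with l f w \<longleftrightarrow>
     (\<forall>b\<ge>l. integrable (lebesgue_on {l..b}) w \<and> f b = f l + (LINT t|lebesgue_on {l..b}. w t))"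

definition loc_abs_cont :: "real \<Rightarrow> (real \<Rightarrow> complex) \<Rightarrow> bool" where
  "loc_abs_cont l f \<longleftrightarrow> (\<exists>w. loc_abs_cont_with l f w)"

text \<open>The derivative at \<open>l\<close> itself is one-sided.\<close>

definition deriv1 :: "real \<Rightarrow> (real \<Rightarrow> complex) \<Rightarrow> real \<Rightarrow> complex" where
  "deriv1 l y x = vector_derivative y (at x within {l..})"

definition regular_fun :: "real \<Rightarrow> (real \<Rightarrow> complex) \<Rightarrow> bool" where
  "regular_fun l y \<longleftrightarrow>
     (\<forall>x\<ge>l. (y has_vector_derivative deriv1 l y x) (at x within {l..})) \<and>
     loc_abs_cont l y \<and> loc_abs_cont l (deriv1 l y)"

text \<open>The choice below is unique up to null sets.\<close>

definition deriv2 :: "real \<Rightarrow> (real \<Rightarrow> complex) \<Rightarrow> real \<Rightarrow> complex" where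
  "deriv2 l y = (SOME w. loc_abs_cont_with l (deriv1 l y) w)"

definition diff_expr :: "real \<Rightarrow> (real \<Rightarrow> real) \<Rightarrow> (real \<Rightarrow> complex) \<Rightarrow> real \<Rightarrow> complex" where
  "diff_expr l q y x = - deriv2 l y x + complex_of_real (q x) * y x"

definition solves :: "real \<Rightarrow> (real \<Rightarrow> real) \<Rightarrow> complex \<Rightarrow> (real \<Rightarrow> complex) \<Rightarrow> bool" where
  "solves l q z y \<longleftrightarrow>
     regular_fun l y \<and> (AE x in lebesgue_on {l..}. diff_expr l q y x = z * y x)"


section \<open>Operators\<close>

text \<open>
  Every operator below acts as \<open>diff_expr l q\<close>; they differ by their domains. \<open>Dstar l q\<close> is the
  domain of the adjoint of the minimal operator.
\<close>

definition Dstar :: "real \<Rightarrow> (real \<Rightarrow> real) \<Rightarrow> (real \<Rightarrow> complex) set" where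
  "Dstar l q = {y. y \<in> L2 l \<and> regular_fun l y \<and> diff_expr l q y \<in> L2 l}"

definition dom_min :: "real \<Rightarrow> (real \<Rightarrow> real) \<Rightarrow> (real \<Rightarrow> complex) set" where
  "dom_min l q = {y \<in> Dstar l q. y l = 0 \<and> deriv1 l y l = 0}"

definition dom_T :: "real \<Rightarrow> (real \<Rightarrow> real) \<Rightarrow> complex \<Rightarrow> (real \<Rightarrow> complex) set" where
  "dom_T l q h = {y \<in> Dstar l q. deriv1 l y l = h * y l}"

definition ker_adj :: "real \<Rightarrow> (real \<Rightarrow> real) \<Rightarrow> complex \<Rightarrow> (real \<Rightarrow> complex) set" where
  "ker_adj l q z = {y \<in> Dstar l q. AE x in lebesgue_on {l..}. diff_expr l q y x = z * y x}"

definition one_dimensional :: "real \<Rightarrow> (real \<Rightarrow> complex) set \<Rightarrow> bool" where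
  "one_dimensional l V \<longleftrightarrow>
     (\<exists>\<psi>\<in>V. (\<exists>x\<ge>l. \<psi> x \<noteq> 0) \<and> (\<forall>y\<in>V. \<exists>c. \<forall>x\<ge>l. y x = c * \<psi> x))"

definition deficiency_indices_1_1 :: "real \<Rightarrow> (real \<Rightarrow> real) \<Rightarrow> bool" where
  "deficiency_indices_1_1 l q \<longleftrightarrow>
     one_dimensional l (ker_adj l q \<i>) \<and> one_dimensional l (ker_adj l q (- \<i>))"

definition nonneg_min_op :: "real \<Rightarrow> (real \<Rightarrow> real) \<Rightarrow> bool" where
  "nonneg_min_op l q \<longleftrightarrow> (\<forall>f\<in>dom_min l q. inner_L2 l (diff_expr l q f) f \<in> \<real>\<^sub>\<ge>\<^sub>0)"

type_synonym 'f form = "'f \<Rightarrow> 'f \<Rightarrow> complex"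

definition accretive :: "'f form \<Rightarrow> 'f set \<Rightarrow> ('f \<Rightarrow> 'f) \<Rightarrow> bool" where
  "accretive ip Dom T \<longleftrightarrow> (\<forall>f\<in>Dom. 0 \<le> Re (ip (T f) f))"

text \<open>
  The last conjunct makes \<open>\<beta>\<close> the exact angle. The set under the supremum is bounded by the second
  conjunct, which also gives \<open>Im = 0\<close> where \<open>Re = 0\<close>; such \<open>f\<close> contribute \<open>0 / 0 = 0\<close>.
\<close>

definition sectorial :: "'f form \<Rightarrow> 'f set \<Rightarrow> ('f \<Rightarrow> 'f) \<Rightarrow> real \<Rightarrow> bool" where
  "sectorial ip Dom T \<beta> \<longleftrightarrow>
     0 < \<beta> \<and> \<beta> < pi / 2 \<and> accretive ip Dom T \<and>
     (\<forall>f\<in>Dom. cot \<beta> * \<bar>Im (ip (T f) f)\<bar> \<le> Re (ip (T f) f)) \<and>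
     tan \<beta> = (SUP f\<in>Dom. \<bar>Im (ip (T f) f)\<bar> / Re (ip (T f) f))"


section \<open>The Weyl function\<close>

definition is_weyl_value :: "real \<Rightarrow> (real \<Rightarrow> real) \<Rightarrow> complex \<Rightarrow> complex \<Rightarrow> bool" where
  "is_weyl_value l q z c \<longleftrightarrow>
     (\<exists>\<phi>1 \<phi>2. solves l q z \<phi>1 \<and> \<phi>1 l = 0 \<and> deriv1 l \<phi>1 l = 1 \<and>
              solves l q z \<phi>2 \<and> \<phi>2 l = -1 \<and> deriv1 l \<phi>2 l = 0 \<and>
              (\<lambda>x. \<phi>2 x + c * \<phi>1 x) \<in> L2 l)"

text \<open>
  If the minimal operator is nonnegative with deficiency indices (1,1), its Dirichlet extension is
  nonnegative (it is the Friedrichs extension), so the Weyl function exists, and is unique, at every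
  point off \<open>[0, \<infinity>)\<close>.
\<close>

definition is_weyl_function :: "real \<Rightarrow> (real \<Rightarrow> real) \<Rightarrow> (complex \<Rightarrow> complex) \<Rightarrow> bool" where
  "is_weyl_function l q M \<longleftrightarrow> (\<forall>z. z \<notin> \<real>\<^sub>\<ge>\<^sub>0 \<longrightarrow> is_weyl_value l q z (M z))"


section \<open>L-systems with one-dimensional channel space\<close>

text \<open>
  An element \<open>\<chi>\<close> of \<open>\<H>\<^sub>-\<close> is represented by the functional \<open>f \<mapsto> (f, \<chi>)\<close> on \<open>\<H>\<^sub>+\<close>; thus \<open>c\<chi>\<close> is
  represented by \<open>f \<mapsto> cnj c * (f, \<chi>)\<close>, and \<open>u \<in> \<H>\<close> by \<open>f \<mapsto> (f, u)\<close>. Equality in \<open>\<H>\<^sub>-\<close> is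
  equality of the functionals on \<open>\<H>\<^sub>+\<close>.
\<close>

type_synonym 'f functional = "'f \<Rightarrow> complex"

record 'f lsystem =
  Hplus :: "'f set"
  ip :: "'f form"
  scale :: "complex \<Rightarrow> 'f \<Rightarrow> 'f"
  main_dom :: "'f set"
  main_op :: "'f \<Rightarrow> 'f"
  state_op :: "'f \<Rightarrow> 'f functional"
  channel :: "complex \<Rightarrow> 'f functional"

text \<open>\<open>K\<^sup>*\<close> is determined by \<open>(f, K c) = (K\<^sup>* f, c) = cnj c * K\<^sup>* f\<close>.\<close>

definition channel_adj :: "'f lsystem \<Rightarrow> 'f \<Rightarrow> complex" where
  "channel_adj \<Theta> f = (THE w. \<forall>c. channel \<Theta> c f = cnj c * w)"

text \<open>\<open>u\<close> represents \<open>(\<bbbA> - z I)\<^sup>-\<^sup>1 K c\<close>.\<close>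

definition is_resolvent_value :: "'f lsystem \<Rightarrow> complex \<Rightarrow> complex \<Rightarrow> 'f \<Rightarrow> bool" where
  "is_resolvent_value \<Theta> z c u \<longleftrightarrow>
     u \<in> Hplus \<Theta> \<and>
     (\<forall>f\<in>Hplus \<Theta>. state_op \<Theta> u f - ip \<Theta> f (scale \<Theta> z u) = channel \<Theta> c f)"

text \<open>\<open>u\<close> is only unique as an element of \<open>\<H>\<^sub>+\<close>, hence the description on the level of values.\<close>

definition transfer :: "'f lsystem \<Rightarrow> complex \<Rightarrow> complex" where
  "transfer \<Theta> z = (THE w. \<exists>u. is_resolvent_value \<Theta> z 1 u \<and> w = 1 - 2 * \<i> * channel_adj \<Theta> u)"

text \<open>The value is \<open>\<infinity>\<close> when the transfer function vanishes at \<open>- \<i>\<close>; recall \<open>ln 0 = 0\<close> in HOL.\<close>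

definition c_entropy :: "'f lsystem \<Rightarrow> ereal" where
  "c_entropy \<Theta> =
     (if transfer \<Theta> (- \<i>) = 0 then \<infinity> else ereal (- ln (cmod (transfer \<Theta> (- \<i>)))))"


section \<open>Schroedinger L-systems\<close>

datatype ext_param = Finite real | Infinite

text \<open>
  \<open>(f, \<mu>\<delta> + \<delta>') = \<mu> f(l) - f'(l)\<close> for real \<open>\<mu>\<close>. For \<open>\<mu> = \<infinity>\<close> one has
  \<open>(\<mu>\<delta> + \<delta>') / (\<mu> - h) \<rightarrow> \<delta>\<close> and \<open>(\<mu>\<delta> + \<delta>') / |\<mu> - h| \<rightarrow> \<delta>\<close> as \<open>\<mu> \<rightarrow> \<infinity>\<close>. Scalars on elements of \<open>\<H>\<^sub>-\<close>
  become conjugated, see the representation above.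
\<close>

fun schr_state_op ::
  "real \<Rightarrow> (real \<Rightarrow> real) \<Rightarrow> ext_param \<Rightarrow> complex \<Rightarrow> (real \<Rightarrow> complex) \<Rightarrow> (real \<Rightarrow> complex) functional"
where
  "schr_state_op l q (Finite \<mu>) h y f =
     inner_L2 l f (diff_expr l q y) -
     cnj (1 / (complex_of_real \<mu> - h) * (deriv1 l y l - h * y l)) *
       (complex_of_real \<mu> * f l - deriv1 l f l)"
| "schr_state_op l q Infinite h y f =
     inner_L2 l f (diff_expr l q y) - cnj (deriv1 l y l - h * y l) * f l"

fun schr_channel ::
  "real \<Rightarrow> ext_param \<Rightarrow> complex \<Rightarrow> complex \<Rightarrow> (real \<Rightarrow> complex) functional"
where
  "schr_channel l (Finite \<mu>) h c f =
     cnj c * (complex_of_real (sqrt (Im h) / cmod (complex_of_real \<mu> - h)) *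
       (complex_of_real \<mu> * f l - deriv1 l f l))"
| "schr_channel l Infinite h c f = cnj c * (complex_of_real (sqrt (Im h)) * f l)"

definition schr_lsystem ::
  "real \<Rightarrow> (real \<Rightarrow> real) \<Rightarrow> ext_param \<Rightarrow> complex \<Rightarrow> (real \<Rightarrow> complex) lsystem" where
  "schr_lsystem l q \<mu> h =
     \<lparr> Hplus = Dstar l q, ip = inner_L2 l, scale = (\<lambda>c y x. c * y x),
       main_dom = dom_T l q h, main_op = diff_expr l q,
       state_op = schr_state_op l q \<mu> h, channel = schr_channel l \<mu> h \<rparr>"

definition dissipation_coeff :: "complex \<Rightarrow> real" where
  "dissipation_coeff h = Im h"

definition admissible ::
  "real \<Rightarrow> (real \<Rightarrow> real) \<Rightarrow> real \<Rightarrow> real \<Rightarrow> ext_param \<Rightarrow> complex \<Rightarrow> bool" where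
  "admissible l q S \<beta> \<mu> h \<longleftrightarrow>
     Im h > 0 \<and>
     c_entropy (schr_lsystem l q \<mu> h) = ereal S \<and>
     sectorial (ip (schr_lsystem l q \<mu> h)) (main_dom (schr_lsystem l q \<mu> h))
       (main_op (schr_lsystem l q \<mu> h)) \<beta>"


section \<open>The extremal value\<close>

definition coth :: "real \<Rightarrow> real" where
  "coth x = cosh x / sinh x"

text \<open>
  For \<open>h = x + \<i>y\<close> with \<open>x = y cot \<beta> - m\<close>, the condition \<open>|m\<^sub>\<infinity>(\<i>) + h| = exp (-S) |m\<^sub>\<infinity>(\<i>) + cnj h|\<close> reads
  \<open>y\<^sup>2 / sin\<^sup>2 \<beta> + 2 (E cot \<beta> - B coth S) y + D = 0\<close> with \<open>D = E\<^sup>2 + B\<^sup>2\<close>. The value below is the smaller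
  root. Mind the factor \<open>1 / sin\<^sup>2 \<beta>\<close> of \<open>D\<close> under the square root: the printed formula has \<open>D\<close> alone
  there, which is never a root of this equation for \<open>0 < \<beta> < pi / 2\<close>.
\<close>

definition min_dissipation :: "real \<Rightarrow> real \<Rightarrow> real \<Rightarrow> real \<Rightarrow> real \<Rightarrow> real" where
  "min_dissipation B D E \<beta> S =
     (sin \<beta>)\<^sup>2 * (B * coth S - E * cot \<beta> -
       sqrt ((E * cot \<beta> - B * coth S)\<^sup>2 - D / (sin \<beta>)\<^sup>2))"

end

theory Submission
  imports Defs
begin

text \<open>
  Both constraints on \<open>h\<close> turn out to be explicit, and they do not involve \<open>\<mu>\<close>: the exact angle
  \<open>\<beta>\<close> puts \<open>h\<close> on a half-line, a given c-entropy puts it on a circle. The dissipation coefficient is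
  the ordinate of a common point, so the minimum is the smaller root of a quadratic equation.

  The half-line (\<open>sectorial_iff\<close>). Write \<open>L\<close> for the differential expression and put
  \<open>Q(f) = Re ((L f, f) - f'(l) cnj f(l))\<close> (\<open>energy\<close>), which is formally \<open>\<integral> |f'|\<^sup>2 + q |f|\<^sup>2\<close>. On the domain of \<open>T\<^sub>h\<close> one has \<open>Re (T\<^sub>h f, f) = Q(f) + Re h |f(l)|\<^sup>2\<close> and
  \<open>Im (T\<^sub>h f, f) = Im h |f(l)|\<^sup>2\<close>, so the exact angle is governed by the infimum of \<open>Q\<close> under
  \<open>f(l) = 1\<close>, \<open>f'(l) = h\<close>. This infimum is \<open>m = m\<^sub>\<infinity>(-0)\<close>. Indeed, for \<open>t < 0\<close> the function
  \<open>g = f + f(l) \<psi>\<^sub>t\<close>, where \<open>\<psi>\<^sub>t\<close> is the Weyl solution at \<open>t\<close>, vanishes at \<open>l\<close>, and completing the square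
  gives \<open>Q(f) = |f(l)|\<^sup>2 m\<^sub>\<infinity>(t) + t \<parallel>f\<parallel>\<^sup>2 + (Q(g) - t \<parallel>g\<parallel>\<^sup>2)\<close>
  (\<open>energy_weyl_decomposition\<close>). The bracket is nonnegative because the Dirichlet extension of a
  nonnegative minimal operator is nonnegative (\<open>energy_dirichlet_nonneg\<close>), which yields the lower
  bound as \<open>t \<rightarrow> 0\<close>; the Weyl solutions themselves show that it is sharp. Their derivative
  at \<open>l\<close> is the wrong one, but functions concentrated near \<open>l\<close> can change \<open>f'(l)\<close> arbitrarily while
  changing \<open>Q(f)\<close> as little as desired (\<open>energy_change_derivative\<close>); the same device transfers
  nonnegativity from the minimal operator to the Dirichlet extension. The outcome is that \<open>T\<^sub>h\<close> is
  \<open>\<beta>\<close>-sectorial with exact angle iff \<open>Re h + m = cot \<beta> Im h\<close>.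

  The circle (\<open>c_entropy_iff\<close>). A multiple of the Weyl solution at \<open>-\<i>\<close> solves the resolvent equation, and
  the dissipativity of the state-space operator makes the value of the channel functional on a solution unique.
  This gives \<open>|W(-\<i>)| = |m\<^sub>\<infinity>(\<i>) + h| / |m\<^sub>\<infinity>(\<i>) + cnj h|\<close> for every \<open>\<mu>\<close>.

  Everything rests on Green's identity on the maximal domain without a contribution from infinity
  (\<open>green\<close>). Nonnegativity makes the quadratic form of the minimal operator real. Every element of the
  maximal domain differs from an element of the minimal domain by a compactly supported function, a cutoff of a solution of
  the differential equation, and for compactly supported functions the identity is integration by parts. Hence
  the defect of Green's identity, a skew-Hermitian form, vanishes on the diagonal, and so everywhere.
  Integration by parts for locally absolutely continuous functions is \<open>loc_abs_cont_with_mult\<close>.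
\<close>

section \<open>Locally absolutely continuous functions\<close>

lemma borel_measurable_lebesgue_on_AE:
  fixes f g :: "'a::euclidean_space \<Rightarrow> 'b::euclidean_space"
  assumes "f \<in> borel_measurable (lebesgue_on S)" "S \<in> sets lebesgue"
    and "AE x in lebesgue_on S. f x = g x"
  shows "g \<in> borel_measurable (lebesgue_on S)"
proof -
  have "(\<lambda>x. if x \<in> S then f x else 0) \<in> borel_measurable lebesgue"
    using assms by (simp add: borel_measurable_if)
  moreover have "AE x in lebesgue. (if x \<in> S then f x else 0) = (if x \<in> S then g x else 0)"
    using assms by (auto simp: AE_restrict_space_iff)
  ultimately have "(\<lambda>x. if x \<in> S then g x else 0) \<in> borel_measurable lebesgue"
    by (rule borel_measurable_AE)
  then show ?thesis using borel_measurable_if_D by blast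
qed

lemma AE_lebesgue_on_subset:
  assumes "AE x in lebesgue_on T. P x" "S \<subseteq> T" "S \<in> sets lebesgue" "T \<in> sets lebesgue"
  shows "AE x in lebesgue_on S. P x"
proof -
  have "AE x in lebesgue. x \<in> T \<longrightarrow> P x"
    using assms(1,4) by (simp add: AE_restrict_space_iff)
  then have "AE x in lebesgue. x \<in> S \<longrightarrow> P x"
    by eventually_elim (use assms(2) in blast)
  then show ?thesis using assms(3) by (simp add: AE_restrict_space_iff)
qed

text \<open>
  Local summability speaks of the intervals \<open>{l..b}\<close>, the Hilbert space of the half-line; null sets
  may be moved between the two.
\<close>

lemma AE_half_line_iff:
  "(AE x in lebesgue_on {l::real..}. P x) \<longleftrightarrow> (\<forall>b\<ge>l. AE x in lebesgue_on {l..b}. P x)"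
proof
  assume L: "AE x in lebesgue_on {l..}. P x"
  show "\<forall>b\<ge>l. AE x in lebesgue_on {l..b}. P x"
    by (intro allI impI AE_lebesgue_on_subset[OF L]) auto
next
  assume R: "\<forall>b\<ge>l. AE x in lebesgue_on {l..b}. P x"
  have "AE x in lebesgue. \<forall>n::nat. x \<in> {l..l + real n} \<longrightarrow> P x"
    unfolding AE_all_countable using R by (auto simp: AE_restrict_space_iff)
  then have "AE x in lebesgue. x \<in> {l..} \<longrightarrow> P x"
  proof eventually_elim
    case (elim x)
    show ?case
    proof
      assume "x \<in> {l..}"
      moreover obtain n where "x - l \<le> real n" using real_arch_simple by blast
      ultimately show "P x" using elim[rule_format, of n] by auto
    qed
  qed
  then show "AE x in lebesgue_on {l..}. P x"
    by (subst AE_restrict_space_iff) auto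
qed

text \<open>
  By Lebesgue differentiation \<open>w\<close> is almost everywhere the limit of its averages over \<open>[x, x + h]\<close>,
  and all these averages vanish. This is what makes the second derivative of a function unique up
  to null sets.
\<close>

lemma AE_eq_0_of_indefinite_integral_0:
  fixes w :: "real \<Rightarrow> complex"
  assumes "\<And>b. b \<ge> l \<Longrightarrow> integrable (lebesgue_on {l..b}) w"
    and "\<And>b. b \<ge> l \<Longrightarrow> (LINT t|lebesgue_on {l..b}. w t) = 0"
  shows "AE x in lebesgue_on {l..}. w x = 0"
proof -
  define f where "f = (\<lambda>x. if x \<in> {l..} then w x else 0)"
  have w: "w integrable_on {l..b}" "integral {l..b} w = 0" if "b \<ge> l" for b
    using integrable_on_lebesgue_on[OF assms(1)[OF that]]
      lebesgue_integral_eq_integral[OF assms(1)[OF that]] assms(2)[OF that] by auto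
  have "f integrable_on cbox a b" for a b
  proof -
    have "w integrable_on {max l a..b}"
    proof (cases "l \<le> b")
      case True
      show ?thesis by (rule integrable_on_subinterval[OF w(1)[OF True]]) auto
    next
      case False
      then have "{max l a..b} = {}" by auto
      then show ?thesis by (simp only: integrable_on_empty)
    qed
    moreover have "{l..} \<inter> cbox a b = {max l a..b}" by auto
    ultimately show ?thesis unfolding f_def integrable_restrict_Int by simp
  qed
  from integrable_ccontinuous_explicit[of f, OF this] obtain N where N: "negligible N"
    and d: "\<And>x e. \<lbrakk>x \<notin> N; 0 < e\<rbrakk> \<Longrightarrow> \<exists>d>0. \<forall>h. 0 < h \<and> h < d \<longrightarrow>
                norm (integral (cbox x (x + h *\<^sub>R One)) f /\<^sub>R h ^ DIM(real) - f x) < e" by blast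
  have "w x = 0" if "x \<notin> N" "x \<ge> l" for x
  proof (rule ccontr)
    assume "w x \<noteq> 0"
    with d[OF that(1), of "norm (w x)"] obtain d where "d > 0"
      and d: "norm (integral (cbox x (x + d/2)) f /\<^sub>R (d/2) - f x) < norm (w x)"
      by (force dest: spec[of _ "_ / 2"])
    have "integral (cbox x (x + d/2)) f = integral {x..x + d/2} w"
      using that by (auto simp: f_def intro!: Henstock_Kurzweil_Integration.integral_cong)
    moreover have "integral {l..x} w + integral {x..x + d/2} w = integral {l..x + d/2} w"
      using that \<open>d > 0\<close> by (intro Henstock_Kurzweil_Integration.integral_combine w) auto
    moreover have "integral {l..x} w = 0" "integral {l..x + d/2} w = 0"
      using that \<open>d > 0\<close> by (auto intro!: w)
    ultimately have "integral (cbox x (x + d/2)) f = 0" by simp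
    with d that show False by (simp add: f_def)
  qed
  then have "AE x in lebesgue. x \<in> {l..} \<longrightarrow> w x = 0"
    using N by (intro AE_I'[of N]) (auto simp: negligible_iff_null_sets)
  then show ?thesis by (subst AE_restrict_space_iff) auto
qed

lemma loc_abs_cont_withI:
  assumes "\<And>b. l \<le> b \<Longrightarrow> integrable (lebesgue_on {l..b}) w"
    and "\<And>b. l \<le> b \<Longrightarrow> (LINT t|lebesgue_on {l..b}. w t) = f b - f l"
  shows "loc_abs_cont_with l f w"
  unfolding loc_abs_cont_with_def
proof (intro allI impI conjI)
  fix b assume "l \<le> b"
  then show "integrable (lebesgue_on {l..b}) w" by (rule assms)
  have "(LINT t|lebesgue_on {l..b}. w t) = f b - f l" by (rule assms) fact
  then show "f b = f l + (LINT t|lebesgue_on {l..b}. w t)" by algebra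
qed

text \<open>
  The integral stands on the left: as a rewrite rule, the defining equation \<open>f b = f l + \<dots>\<close> would
  apply to its own right-hand side.
\<close>

lemma loc_abs_cont_withD:
  assumes "loc_abs_cont_with l f w" "l \<le> b"
  shows "integrable (lebesgue_on {l..b}) w"
    and "(LINT t|lebesgue_on {l..b}. w t) = f b - f l"
proof -
  have "f b = f l + (LINT t|lebesgue_on {l..b}. w t)"
    using assms unfolding loc_abs_cont_with_def by blast
  then show "(LINT t|lebesgue_on {l..b}. w t) = f b - f l" by algebra
qed (use assms in \<open>unfold loc_abs_cont_with_def, blast\<close>)

lemma loc_abs_cont_with_unique:
  assumes "loc_abs_cont_with l f v" "loc_abs_cont_with l f w"
  shows "AE x in lebesgue_on {l..}. v x = w x"
proof -
  have "AE x in lebesgue_on {l..}. v x - w x = 0"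
    using assms by (intro AE_eq_0_of_indefinite_integral_0)
      (auto simp: loc_abs_cont_withD)
  then show ?thesis by simp
qed

lemma loc_abs_cont_with_eq:
  assumes "loc_abs_cont_with l f w" "\<And>x. x \<ge> l \<Longrightarrow> g x = f x"
    "AE x in lebesgue_on {l..}. w x = v x"
  shows "loc_abs_cont_with l g v"
proof (rule loc_abs_cont_withI)
  fix b assume b: "l \<le> b"
  have i: "integrable (lebesgue_on {l..b}) w" and
    e: "(LINT t|lebesgue_on {l..b}. w t) = f b - f l"
    using loc_abs_cont_withD[OF assms(1) b] by auto
  have ae: "AE x in lebesgue_on {l..b}. w x = v x"
    using assms(3) b by (simp add: AE_half_line_iff)
  have m: "v \<in> borel_measurable (lebesgue_on {l..b})"
    by (rule borel_measurable_lebesgue_on_AE[OF _ _ ae]) (use i in auto)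
  show "integrable (lebesgue_on {l..b}) v"
    by (rule integrable_cong_AE_imp[OF i m ae])
  have "(LINT t|lebesgue_on {l..b}. w t) = (LINT t|lebesgue_on {l..b}. v t)"
    using i m ae by (intro integral_cong_AE) auto
  then show "(LINT t|lebesgue_on {l..b}. v t) = g b - g l"
    using e assms(2) b by simp
qed

lemma loc_abs_cont_with_add:
  assumes "loc_abs_cont_with l f F" "loc_abs_cont_with l g G"
  shows "loc_abs_cont_with l (\<lambda>x. f x + g x) (\<lambda>x. F x + G x)"
  using assms by (intro loc_abs_cont_withI) (auto simp: loc_abs_cont_withD)

lemma loc_abs_cont_with_cmult:
  assumes "loc_abs_cont_with l f F"
  shows "loc_abs_cont_with l (\<lambda>x. c * f x) (\<lambda>x. c * F x)"
  using assms by (intro loc_abs_cont_withI) (auto simp: loc_abs_cont_withD right_diff_distrib)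

lemma loc_abs_cont_with_cnj:
  assumes "loc_abs_cont_with l f F"
  shows "loc_abs_cont_with l (\<lambda>x. cnj (f x)) (\<lambda>x. cnj (F x))"
  using assms by (intro loc_abs_cont_withI) (auto simp: loc_abs_cont_withD)

lemma loc_abs_cont_with_continuous:
  assumes "loc_abs_cont_with l f F"
  shows "continuous_on {l..b} f"
proof (cases "b \<ge> l")
  case True
  with assms have "integrable (lebesgue_on {l..b}) F" by (simp add: loc_abs_cont_withD)
  then have "continuous_on {l..b} (\<lambda>x. f l + (LINT t|lebesgue_on {l..x}. F t))"
    by (intro continuous_intros indefinite_integral_continuous_real)
  then show ?thesis
    by (rule continuous_on_eq) (use assms in \<open>auto simp: loc_abs_cont_withD\<close>)
qed simp

lemma integrable_mult_continuous:
  fixes F g :: "real \<Rightarrow> complex"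
  assumes "integrable (lebesgue_on {a..b}) F" "continuous_on {a..b} g"
  shows "integrable (lebesgue_on {a..b}) (\<lambda>x. F x * g x)"
proof -
  obtain B where "\<forall>y\<in>g ` {a..b}. norm y \<le> B"
    using compact_imp_bounded[OF compact_continuous_image[OF assms(2)]]
    unfolding bounded_iff by auto
  then have B: "norm (g x) \<le> B" if "x \<in> {a..b}" for x using that by blast
  have [measurable]: "g \<in> borel_measurable (lebesgue_on {a..b})"
    using assms(2) by (intro continuous_imp_measurable_on_sets_lebesgue) auto
  have [measurable]: "F \<in> borel_measurable (lebesgue_on {a..b})"
    using assms(1) by auto
  show ?thesis
  proof (rule measurable_bounded_by_integrable_imp_lebesgue_integrable)
    show "integrable (lebesgue_on {a..b}) (\<lambda>x. B * norm (F x))"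
      using assms(1) by auto
    show "cmod (F x * g x) \<le> B * norm (F x)" if "x \<in> {a..b}" for x
      using mult_right_mono[OF B[OF that], of "norm (F x)"] by (simp add: norm_mult mult.commute)
  qed auto
qed

text \<open>
  Let \<open>R x y\<close> be the amount by which the product rule fails on \<open>[x, y]\<close>. It is additive in the
  interval, and \<open>R x y = \<integral> F(t) (g(y) - g(t)) + G(t) (f(x) - f(t)) dt\<close>. So, by continuity of \<open>f\<close>
  and \<open>g\<close>, it is bounded on all short intervals by \<open>e\<close> times the additive function \<open>V x y = \<integral> |F| +
  |G|\<close>. Bolzano's bisection argument spreads this bound to \<open>[l, b]\<close>, and \<open>e\<close> is arbitrary.
\<close>

lemma loc_abs_cont_with_mult:
  assumes f: "loc_abs_cont_with l f F" and g: "loc_abs_cont_with l g G"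
  shows "loc_abs_cont_with l (\<lambda>x. f x * g x) (\<lambda>x. F x * g x + f x * G x)"
proof (rule loc_abs_cont_withI)
  fix b assume b: "l \<le> b"
  define h where "h = (\<lambda>x. F x * g x + f x * G x)"
  have iF: "integrable (lebesgue_on {x..y}) F" and iG: "integrable (lebesgue_on {x..y}) G"
    if "l \<le> x" for x y
  proof -
    have "integrable (lebesgue_on {l..max l y}) F" "integrable (lebesgue_on {l..max l y}) G"
      using loc_abs_cont_withD(1)[OF f, of "max l y"] loc_abs_cont_withD(1)[OF g, of "max l y"] by auto
    moreover have "{x..y} \<subseteq> {l..max l y}" using that by auto
    ultimately show "integrable (lebesgue_on {x..y}) F" "integrable (lebesgue_on {x..y}) G"
      using integrable_subinterval by blast+
  qed
  have cf: "continuous_on {x..y} f" and cg: "continuous_on {x..y} g" if "l \<le> x" for x y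
    using loc_abs_cont_with_continuous[OF f, of y] loc_abs_cont_with_continuous[OF g, of y] that
    by (auto elim!: continuous_on_subset)
  have ih: "integrable (lebesgue_on {x..y}) h" if "l \<le> x" for x y
    unfolding h_def
  proof (rule Bochner_Integration.integrable_add)
    show "integrable (lebesgue_on {x..y}) (\<lambda>x. F x * g x)"
      using that by (intro integrable_mult_continuous iF cg)
    show "integrable (lebesgue_on {x..y}) (\<lambda>x. f x * G x)"
      using that integrable_mult_continuous[OF iG cf, of x y] by (simp add: mult.commute)
  qed
  have df: "f y - f x = (LINT t|lebesgue_on {x..y}. F t)"
    and dg: "g y - g x = (LINT t|lebesgue_on {x..y}. G t)" if "l \<le> x" "x \<le> y" for x y
    using integral_combine[OF iF[of l y], of x] integral_combine[OF iG[of l y], of x] that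
      loc_abs_cont_withD(2)[OF f] loc_abs_cont_withD(2)[OF g] by auto
  define R where "R x y = f y * g y - f x * g x - (LINT t|lebesgue_on {x..y}. h t)" for x y
  define V where "V x y = (LINT t|lebesgue_on {x..y}. norm (F t) + norm (G t))" for x y
  have R_add: "R x z = R x y + R y z" and V_add: "V x z = V x y + V y z"
    if "l \<le> x" "x \<le> y" "y \<le> z" for x y z
    using that integral_combine[OF ih[of x z], of y]
      integral_combine[of x z "\<lambda>t. norm (F t) + norm (G t)" y] iF[of x z] iG[of x z]
    by (auto simp: R_def V_def)
  have small: "norm (R l b) \<le> e * V l b" if e: "e > 0" for e
  proof -
    have "l \<le> l \<longrightarrow> b \<le> b \<longrightarrow> norm (R l b) \<le> e * V l b"
    proof (rule Bolzano[OF b, of "\<lambda>x y. l \<le> x \<longrightarrow> y \<le> b \<longrightarrow> norm (R x y) \<le> e * V x y"])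
      fix x y z
      assume *: "l \<le> x \<longrightarrow> y \<le> b \<longrightarrow> cmod (R x y) \<le> e * V x y"
        "l \<le> y \<longrightarrow> z \<le> b \<longrightarrow> cmod (R y z) \<le> e * V y z" "x \<le> y" "y \<le> z"
      show "l \<le> x \<longrightarrow> z \<le> b \<longrightarrow> cmod (R x z) \<le> e * V x z"
      proof safe
        assume "l \<le> x" "z \<le> b"
        then show "cmod (R x z) \<le> e * V x z"
          using * norm_triangle_ineq[of "R x y" "R y z"]
          by (auto simp: R_add[of x y z] V_add[of x y z] distrib_left)
      qed
    next
      fix c assume c: "l \<le> c" "c \<le> b"
      obtain d1 where d1: "d1 > 0" "\<And>t. \<lbrakk>t \<in> {l..b}; dist t c < d1\<rbrakk> \<Longrightarrow> dist (f t) (f c) < e / 2"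
        using cf[OF order_refl, of b] c half_gt_zero[OF e] unfolding continuous_on_iff
        by (metis atLeastAtMost_iff)
      obtain d2 where d2: "d2 > 0" "\<And>t. \<lbrakk>t \<in> {l..b}; dist t c < d2\<rbrakk> \<Longrightarrow> dist (g t) (g c) < e / 2"
        using cg[OF order_refl, of b] c half_gt_zero[OF e] unfolding continuous_on_iff
        by (metis atLeastAtMost_iff)
      show "\<exists>d>0. \<forall>x y. x \<le> c \<and> c \<le> y \<and> y - x < d \<longrightarrow> l \<le> x \<longrightarrow> y \<le> b \<longrightarrow> cmod (R x y) \<le> e * V x y"
      proof (intro exI[of _ "min d1 d2"] conjI allI impI)
        show "min d1 d2 > 0" using d1 d2 by simp
        fix x y assume xy: "x \<le> c \<and> c \<le> y \<and> y - x < min d1 d2" "l \<le> x" "y \<le> b"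
        have osc: "norm (f s - f t) \<le> e" "norm (g s - g t) \<le> e" if "s \<in> {x..y}" "t \<in> {x..y}" for s t
        proof -
          have near: "u \<in> {l..b}" "dist u c < d1" "dist u c < d2" if "u \<in> {x..y}" for u
            using xy that by (auto simp: dist_real_def)
          have "dist (f s) (f c) < e/2" "dist (f t) (f c) < e/2"
            "dist (g s) (g c) < e/2" "dist (g t) (g c) < e/2"
            using that by (blast intro: d1(2) d2(2) near)+
          then show "norm (f s - f t) \<le> e" "norm (g s - g t) \<le> e"
            unfolding dist_norm[symmetric] by (metis dist_triangle_half_l less_imp_le)+
        qed
        have i1: "integrable (lebesgue_on {x..y}) (\<lambda>t. F t * (g y - g t))"
          using xy by (intro integrable_mult_continuous iF continuous_intros cg) auto
        have i2: "integrable (lebesgue_on {x..y}) (\<lambda>t. G t * (f x - f t))"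
          using xy by (intro integrable_mult_continuous iG continuous_intros cf) auto
        have iFx: "integrable (lebesgue_on {x..y}) F" and iGx: "integrable (lebesgue_on {x..y}) G"
          and ihx: "integrable (lebesgue_on {x..y}) h"
          using iF iG ih xy by auto
        have "f y * g y - f x * g x = (f y - f x) * g y + f x * (g y - g x)"
          by (simp add: algebra_simps)
        also have "\<dots> = (LINT t|lebesgue_on {x..y}. F t * g y + f x * G t)"
          using xy iFx iGx by (simp add: df dg)
        finally have "R x y = (LINT t|lebesgue_on {x..y}. F t * g y + f x * G t - h t)"
          unfolding R_def using iFx iGx ihx by simp
        also have "\<dots> = (LINT t|lebesgue_on {x..y}. F t * (g y - g t) + G t * (f x - f t))"
          by (simp add: h_def algebra_simps)
        finally have "norm (R x y) \<le> (LINT t|lebesgue_on {x..y}. norm (F t * (g y - g t) + G t * (f x - f t)))"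
          by simp
        also have "\<dots> \<le> (LINT t|lebesgue_on {x..y}. e * (norm (F t) + norm (G t)))"
        proof (rule integral_mono)
          show "integrable (lebesgue_on {x..y}) (\<lambda>t. norm (F t * (g y - g t) + G t * (f x - f t)))"
            using i1 i2 by auto
          show "integrable (lebesgue_on {x..y}) (\<lambda>t. e * (norm (F t) + norm (G t)))"
            using iFx iGx by auto
          fix t assume "t \<in> space (lebesgue_on {x..y})"
          then have t: "t \<in> {x..y}" by simp
          have "norm (F t * (g y - g t) + G t * (f x - f t)) \<le> norm (F t) * norm (g y - g t) + norm (G t) * norm (f x - f t)"
            by (metis norm_mult norm_triangle_ineq)
          also have "\<dots> \<le> norm (F t) * e + norm (G t) * e"
            using osc(1)[of x t] osc(2)[of y t] t by (intro add_mono mult_left_mono) auto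
          finally show "norm (F t * (g y - g t) + G t * (f x - f t)) \<le> e * (norm (F t) + norm (G t))"
            by (simp add: algebra_simps)
        qed
        also have "\<dots> = e * V x y" by (simp add: V_def)
        finally show "norm (R x y) \<le> e * V x y" .
      qed
    qed
    then show ?thesis by simp
  qed
  have V: "V l b \<ge> 0" by (simp add: V_def)
  have "norm (R l b) \<le> 0 + e" if "e > 0" for e
  proof -
    have "norm (R l b) \<le> e / (V l b + 1) * V l b"
      using small[of "e / (V l b + 1)"] that V by simp
    also have "\<dots> \<le> e" using that V by (simp add: field_simps)
    finally show ?thesis by simp
  qed
  then have "norm (R l b) \<le> 0" by (rule field_le_epsilon)
  then have "R l b = 0" by simp
  then show "integrable (lebesgue_on {l..b}) (\<lambda>x. F x * g x + f x * G x)"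
    "(LINT t|lebesgue_on {l..b}. F t * g t + f t * G t) = f b * g b - f l * g l"
    using ih[of l b] by (auto simp: R_def h_def)
qed

lemma loc_abs_cont_with_C1:
  assumes "\<And>x. l \<le> x \<Longrightarrow> (y has_vector_derivative y1 x) (at x within {l..})"
    and "\<And>b. continuous_on {l..b} y1"
  shows "loc_abs_cont_with l y y1"
proof (rule loc_abs_cont_withI)
  fix b assume b: "l \<le> b"
  show i: "integrable (lebesgue_on {l..b}) y1"
    by (intro continuous_imp_integrable_real assms)
  have "(y1 has_integral y b - y l) {l..b}"
    using b by (intro fundamental_theorem_of_calculus)
      (auto intro: has_vector_derivative_within_subset[OF assms(1)])
  then show "(LINT t|lebesgue_on {l..b}. y1 t) = y b - y l"
    using lebesgue_integral_eq_integral[OF i] by (simp add: integral_unique)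
qed

section \<open>Functions with a locally absolutely continuous derivative\<close>

lemma at_within_half_line:
  assumes "x \<ge> l"
  shows "at x within {l::real..} \<noteq> bot"
proof -
  have "x islimpt {x..x+1}" by (simp add: islimpt_Icc)
  then have "x islimpt {l..}" by (rule islimpt_subset) (use assms in auto)
  then show ?thesis by (simp add: trivial_limit_within)
qed

text \<open>
  A function together with its first derivative and a representative \<open>w\<close> of the second one.
  Carrying \<open>w\<close> along allows pointwise computations, whereas \<open>deriv2\<close> is an arbitrary choice within
  its class modulo null sets.
\<close>

definition jet :: "real \<Rightarrow> (real \<Rightarrow> complex) \<Rightarrow> (real \<Rightarrow> complex) \<Rightarrow> (real \<Rightarrow> complex) \<Rightarrow> bool" where
  "jet l y y1 w \<longleftrightarrow>
     (\<forall>x\<ge>l. (y has_vector_derivative y1 x) (at x within {l..})) \<and> loc_abs_cont_with l y1 w"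

lemma jet_deriv1: "jet l y y1 w \<Longrightarrow> l \<le> x \<Longrightarrow> deriv1 l y x = y1 x"
  unfolding jet_def deriv1_def by (simp add: at_within_half_line vector_derivative_within)

lemma jet_loc_abs_cont_with: "jet l y y1 w \<Longrightarrow> loc_abs_cont_with l y y1"
  by (rule loc_abs_cont_with_C1) (auto simp: jet_def intro: loc_abs_cont_with_continuous)

lemma jet_regular_fun:
  assumes "jet l y y1 w"
  shows "regular_fun l y"
proof -
  have "loc_abs_cont_with l (deriv1 l y) w"
    by (rule loc_abs_cont_with_eq[of l y1 w]) (use assms jet_deriv1[OF assms] in \<open>auto simp: jet_def\<close>)
  then show ?thesis
    using jet_loc_abs_cont_with[OF assms] assms jet_deriv1[OF assms]
    unfolding regular_fun_def loc_abs_cont_def by (auto simp: jet_def)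
qed

lemma regular_fun_jet:
  assumes "regular_fun l y"
  shows "jet l y (deriv1 l y) (deriv2 l y)"
  using assms unfolding regular_fun_def jet_def loc_abs_cont_def deriv2_def
  by (metis someI_ex)

lemma jet_deriv2:
  assumes "jet l y y1 w"
  shows "AE x in lebesgue_on {l..}. deriv2 l y x = w x"
proof -
  have 1: "loc_abs_cont_with l (deriv1 l y) (deriv2 l y)"
    using regular_fun_jet[OF jet_regular_fun[OF assms]] by (simp add: jet_def)
  have "loc_abs_cont_with l y1 (deriv2 l y)"
    by (rule loc_abs_cont_with_eq[OF 1]) (use jet_deriv1[OF assms] in auto)
  with assms show ?thesis by (metis jet_def loc_abs_cont_with_unique)
qed

lemma jet_continuous: "jet l y y1 w \<Longrightarrow> continuous_on {l..b} y"
  and jet_continuous1: "jet l y y1 w \<Longrightarrow> continuous_on {l..b} y1"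
  by (auto intro: loc_abs_cont_with_continuous dest: jet_loc_abs_cont_with)
    (auto simp: jet_def intro: loc_abs_cont_with_continuous)

lemma jet_add:
  "jet l y y1 w \<Longrightarrow> jet l z z1 v \<Longrightarrow> jet l (\<lambda>x. y x + z x) (\<lambda>x. y1 x + z1 x) (\<lambda>x. w x + v x)"
  by (auto simp: jet_def intro: loc_abs_cont_with_add derivative_intros)

lemma jet_cmult:
  "jet l y y1 w \<Longrightarrow> jet l (\<lambda>x. c * y x) (\<lambda>x. c * y1 x) (\<lambda>x. c * w x)"
  by (auto simp: jet_def intro!: loc_abs_cont_with_cmult has_vector_derivative_mult_right)

lemma jet_mult:
  assumes "jet l y y1 w" "jet l z z1 v"
  shows "jet l (\<lambda>x. y x * z x) (\<lambda>x. y1 x * z x + y x * z1 x)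
    (\<lambda>x. w x * z x + 2 * (y1 x * z1 x) + y x * v x)"
  unfolding jet_def
proof
  show "\<forall>x\<ge>l. ((\<lambda>x. y x * z x) has_vector_derivative y1 x * z x + y x * z1 x) (at x within {l..})"
    using assms by (auto simp: jet_def add.commute intro!: has_vector_derivative_mult[THEN has_vector_derivative_eq_rhs])
  have "loc_abs_cont_with l (\<lambda>x. y1 x * z x + y x * z1 x)
     (\<lambda>x. (w x * z x + y1 x * z1 x) + (y1 x * z1 x + y x * v x))"
    using assms jet_loc_abs_cont_with[OF assms(1)] jet_loc_abs_cont_with[OF assms(2)]
    by (intro loc_abs_cont_with_add loc_abs_cont_with_mult) (auto simp: jet_def)
  then show "loc_abs_cont_with l (\<lambda>x. y1 x * z x + y x * z1 x)
     (\<lambda>x. w x * z x + 2 * (y1 x * z1 x) + y x * v x)"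
    by (simp add: algebra_simps)
qed

lemma continuous_on_half_lineI:
  assumes "\<And>b. continuous_on {l::real..b} (f::real \<Rightarrow> complex)"
  shows "continuous_on {l..} f"
  unfolding continuous_on_eq_continuous_within
proof
  fix x assume x: "x \<in> {l..}"
  have "continuous (at x within {l..x+1}) f"
    using assms[of "x+1"] x by (auto simp: continuous_on_eq_continuous_within)
  moreover have "at x within {l..x+1} = at x within {l..}"
    by (rule at_within_nhd[of x "{..<x+1}"]) auto
  ultimately show "continuous (at x within {l..}) f" by (simp add: continuous_within)
qed

section \<open>The Hilbert space\<close>

lemma borel_measurable_cnj [measurable (raw)]:
  "f \<in> borel_measurable M \<Longrightarrow> (\<lambda>x. cnj (f x)) \<in> borel_measurable M"
  by (rule measurable_compose[OF _ borel_measurable_continuous_onI]) (auto intro: continuous_intros)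

lemma L2_cmult: "f \<in> L2 l \<Longrightarrow> (\<lambda>x. c * f x) \<in> L2 l"
  by (auto simp: L2_def norm_mult power_mult_distrib)

lemma L2_integrable_mult:
  assumes "f \<in> L2 l" "g \<in> L2 l"
  shows "integrable (lebesgue_on {l..}) (\<lambda>x. f x * cnj (g x))"
proof (rule Bochner_Integration.integrable_bound)
  show "integrable (lebesgue_on {l..}) (\<lambda>x. (cmod (f x))\<^sup>2 + (cmod (g x))\<^sup>2)"
    using assms by (auto simp: L2_def)
  have [measurable]: "f \<in> borel_measurable (lebesgue_on {l..})" "g \<in> borel_measurable (lebesgue_on {l..})"
    using assms by (auto simp: L2_def)
  show "(\<lambda>x. f x * cnj (g x)) \<in> borel_measurable (lebesgue_on {l..})" by simp
  have "cmod (f x * cnj (g x)) \<le> norm ((cmod (f x))\<^sup>2 + (cmod (g x))\<^sup>2)" for x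
  proof -
    have "0 \<le> cmod (f x) * cmod (g x)" by simp
    then have "cmod (f x) * cmod (g x) \<le> (cmod (f x))\<^sup>2 + (cmod (g x))\<^sup>2"
      using sum_squares_bound[of "cmod (f x)" "cmod (g x)"] unfolding mult.assoc by linarith
    then show ?thesis by (simp add: norm_mult)
  qed
  then show "AE x in lebesgue_on {l..}. cmod (f x * cnj (g x)) \<le> norm ((cmod (f x))\<^sup>2 + (cmod (g x))\<^sup>2)"
    by simp
qed

lemma L2_add:
  assumes "f \<in> L2 l" "g \<in> L2 l"
  shows "(\<lambda>x. f x + g x) \<in> L2 l"
proof -
  have m[measurable]: "f \<in> borel_measurable (lebesgue_on {l..})" "g \<in> borel_measurable (lebesgue_on {l..})"
    using assms by (auto simp: L2_def)
  have "integrable (lebesgue_on {l..}) (\<lambda>x. (cmod (f x + g x))\<^sup>2)"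
  proof (rule Bochner_Integration.integrable_bound)
    show "integrable (lebesgue_on {l..}) (\<lambda>x. 2 * ((cmod (f x))\<^sup>2 + (cmod (g x))\<^sup>2))"
      using assms by (auto simp: L2_def)
    have "(cmod (f x + g x))\<^sup>2 \<le> 2 * ((cmod (f x))\<^sup>2 + (cmod (g x))\<^sup>2)" for x
    proof -
      have "(cmod (f x + g x))\<^sup>2 \<le> (cmod (f x) + cmod (g x))\<^sup>2"
        by (intro power_mono norm_triangle_ineq) auto
      also have "\<dots> \<le> 2 * ((cmod (f x))\<^sup>2 + (cmod (g x))\<^sup>2)"
        using sum_squares_bound[of "cmod (f x)" "cmod (g x)"] by (simp add: power2_sum)
      finally show ?thesis .
    qed
    then show "AE x in lebesgue_on {l..}. norm ((cmod (f x + g x))\<^sup>2) \<le> norm (2 * ((cmod (f x))\<^sup>2 + (cmod (g x))\<^sup>2))"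
      by auto
  qed simp
  then show ?thesis by (simp add: L2_def)
qed

lemma L2_AE:
  assumes "f \<in> L2 l" "AE x in lebesgue_on {l..}. g x = f x"
  shows "g \<in> L2 l"
proof -
  have ae: "AE x in lebesgue_on {l..}. f x = g x"
    using assms(2) by eventually_elim simp
  have [measurable]: "f \<in> borel_measurable (lebesgue_on {l..})" using assms by (auto simp: L2_def)
  have m[measurable]: "g \<in> borel_measurable (lebesgue_on {l..})"
    by (rule borel_measurable_lebesgue_on_AE[OF _ _ ae]) auto
  have "integrable (lebesgue_on {l..}) (\<lambda>x. (cmod (g x))\<^sup>2)"
  proof (rule integrable_cong_AE_imp)
    show "integrable (lebesgue_on {l..}) (\<lambda>x. (cmod (f x))\<^sup>2)" using assms by (simp add: L2_def)
    show "AE x in lebesgue_on {l..}. (cmod (f x))\<^sup>2 = (cmod (g x))\<^sup>2"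
      using ae by eventually_elim simp
  qed simp
  with m show ?thesis by (simp add: L2_def)
qed

lemma L2_compact_support:
  assumes "continuous_on {l..} f" "\<And>x. x \<ge> b \<Longrightarrow> f x = 0"
  shows "f \<in> L2 l"
proof -
  have m: "f \<in> borel_measurable (lebesgue_on {l..})"
    using assms(1) by (intro continuous_imp_measurable_on_sets_lebesgue) auto
  have "integrable (lebesgue_on {l..b}) (\<lambda>x. (cmod (f x))\<^sup>2)"
    using assms(1) by (intro continuous_imp_integrable_real continuous_intros) (auto elim: continuous_on_subset)
  then have "integrable lebesgue (\<lambda>x. if x \<in> {l..b} then (cmod (f x))\<^sup>2 else 0)"
    by (subst Lebesgue_Measure.integrable_restrict_UNIV) auto
  also have "(\<lambda>x. if x \<in> {l..b} then (cmod (f x))\<^sup>2 else 0) = (\<lambda>x. if x \<in> {l..} then (cmod (f x))\<^sup>2 else 0)"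
    using assms(2) by auto
  finally have "integrable (lebesgue_on {l..}) (\<lambda>x. (cmod (f x))\<^sup>2)"
    by (subst (asm) Lebesgue_Measure.integrable_restrict_UNIV) auto
  with m show ?thesis by (simp add: L2_def)
qed

lemma inner_L2_add_left:
  "\<lbrakk>f \<in> L2 l; f' \<in> L2 l; g \<in> L2 l\<rbrakk> \<Longrightarrow> inner_L2 l (\<lambda>x. f x + f' x) g = inner_L2 l f g + inner_L2 l f' g"
  by (simp add: inner_L2_def distrib_right L2_integrable_mult)

lemma inner_L2_add_right:
  "\<lbrakk>f \<in> L2 l; g \<in> L2 l; g' \<in> L2 l\<rbrakk> \<Longrightarrow> inner_L2 l f (\<lambda>x. g x + g' x) = inner_L2 l f g + inner_L2 l f g'"
  by (simp add: inner_L2_def distrib_left L2_integrable_mult)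

lemma inner_L2_cmult_left: "inner_L2 l (\<lambda>x. c * f x) g = c * inner_L2 l f g"
  by (simp add: inner_L2_def mult.assoc)

lemma inner_L2_cmult_right: "inner_L2 l f (\<lambda>x. c * g x) = cnj c * inner_L2 l f g"
  by (simp add: inner_L2_def mult.left_commute)

lemma inner_L2_cnj: "inner_L2 l g f = cnj (inner_L2 l f g)"
  unfolding inner_L2_def by (subst Bochner_Integration.integral_cnj[symmetric]) (simp add: mult.commute)

lemma inner_L2_AE:
  assumes "f \<in> L2 l" "g \<in> L2 l" 
    "AE x in lebesgue_on {l..}. f' x = f x" "AE x in lebesgue_on {l..}. g' x = g x"
  shows "inner_L2 l f' g' = inner_L2 l f g"
proof -
  have "f' \<in> L2 l" "g' \<in> L2 l" using assms L2_AE by auto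
  then have [measurable]: "f \<in> borel_measurable (lebesgue_on {l..})" "g \<in> borel_measurable (lebesgue_on {l..})"
    "f' \<in> borel_measurable (lebesgue_on {l..})" "g' \<in> borel_measurable (lebesgue_on {l..})"
    using assms by (auto simp: L2_def)
  have "AE x in lebesgue_on {l..}. f' x * cnj (g' x) = f x * cnj (g x)"
    using assms(3,4) by eventually_elim simp
  then show ?thesis unfolding inner_L2_def by (intro integral_cong_AE) auto
qed

definition norm2_L2 :: "real \<Rightarrow> (real \<Rightarrow> complex) \<Rightarrow> real" where
  "norm2_L2 l f = (LINT x|lebesgue_on {l..}. (cmod (f x))\<^sup>2)"

lemma inner_L2_self: "inner_L2 l f f = complex_of_real (norm2_L2 l f)"
  unfolding inner_L2_def norm2_L2_def by (simp add: complex_norm_square flip: integral_complex_of_real of_real_power)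

lemma norm2_L2_nonneg: "0 \<le> norm2_L2 l f"
  by (simp add: norm2_L2_def)

text \<open>
  A function of norm zero is only zero almost everywhere; all that matters is that inner products
  do not see it.
\<close>

lemma inner_L2_norm2_0:
  assumes "f \<in> L2 l" "norm2_L2 l f = 0"
  shows "inner_L2 l f g = 0"
proof -
  have "AE x in lebesgue_on {l..}. (cmod (f x))\<^sup>2 = 0"
    using assms by (subst (asm) norm2_L2_def, subst (asm) integral_nonneg_eq_0_iff_AE) (auto simp: L2_def)
  then have "AE x in lebesgue_on {l..}. f x * cnj (g x) = 0"
    by eventually_elim simp
  then show ?thesis unfolding inner_L2_def by (rule integral_eq_zero_AE)
qed

section \<open>The maximal domain\<close>

text \<open>
  The chosen representative \<open>deriv2\<close> may be replaced by any other one.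
\<close>

lemma DstarI:
  assumes "jet l y y1 w" "y \<in> L2 l" "g \<in> L2 l"
    and "AE x in lebesgue_on {l..}. - w x + complex_of_real (q x) * y x = g x"
  shows "y \<in> Dstar l q" "AE x in lebesgue_on {l..}. diff_expr l q y x = g x"
proof -
  show ae: "AE x in lebesgue_on {l..}. diff_expr l q y x = g x"
    using assms(4) jet_deriv2[OF assms(1)] by eventually_elim (simp add: diff_expr_def)
  then show "y \<in> Dstar l q"
    using assms jet_regular_fun[OF assms(1)] L2_AE[OF assms(3) ae] by (simp add: Dstar_def)
qed

lemma Dstar_jet: "y \<in> Dstar l q \<Longrightarrow> jet l y (deriv1 l y) (deriv2 l y)"
  by (auto simp: Dstar_def intro: regular_fun_jet)

lemma Dstar_lincomb:
  assumes "y \<in> Dstar l q" "z \<in> Dstar l q"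
  shows "(\<lambda>x. y x + c * z x) \<in> Dstar l q"
    and "AE x in lebesgue_on {l..}. diff_expr l q (\<lambda>x. y x + c * z x) x = diff_expr l q y x + c * diff_expr l q z x"
    and "deriv1 l (\<lambda>x. y x + c * z x) l = deriv1 l y l + c * deriv1 l z l"
proof -
  have j: "jet l (\<lambda>x. y x + c * z x) (\<lambda>x. deriv1 l y x + c * deriv1 l z x) (\<lambda>x. deriv2 l y x + c * deriv2 l z x)"
    using assms by (intro jet_add jet_cmult Dstar_jet)
  have L: "(\<lambda>x. y x + c * z x) \<in> L2 l" "(\<lambda>x. diff_expr l q y x + c * diff_expr l q z x) \<in> L2 l"
    using assms by (auto simp: Dstar_def intro!: L2_add L2_cmult)
  have ae: "AE x in lebesgue_on {l..}. - (deriv2 l y x + c * deriv2 l z x) + complex_of_real (q x) * (y x + c * z x) =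
      diff_expr l q y x + c * diff_expr l q z x"
    by (simp add: diff_expr_def algebra_simps)
  show "(\<lambda>x. y x + c * z x) \<in> Dstar l q"
    "AE x in lebesgue_on {l..}. diff_expr l q (\<lambda>x. y x + c * z x) x = diff_expr l q y x + c * diff_expr l q z x"
    using DstarI[OF j L ae] by auto
  show "deriv1 l (\<lambda>x. y x + c * z x) l = deriv1 l y l + c * deriv1 l z l"
    using jet_deriv1[OF j, of l] by simp
qed

lemma DstarD: "y \<in> Dstar l q \<Longrightarrow> y \<in> L2 l" "y \<in> Dstar l q \<Longrightarrow> diff_expr l q y \<in> L2 l"
  by (auto simp: Dstar_def)

lemma inner_diff_expr_lincomb_left:
  assumes "y \<in> Dstar l q" "z \<in> Dstar l q" "g \<in> L2 l"
  shows "inner_L2 l (diff_expr l q (\<lambda>x. y x + c * z x)) g = 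
     inner_L2 l (diff_expr l q y) g + c * inner_L2 l (diff_expr l q z) g"
proof -
  have L: "diff_expr l q y \<in> L2 l" "(\<lambda>x. c * diff_expr l q z x) \<in> L2 l"
    using assms by (auto intro: DstarD L2_cmult)
  show ?thesis
    using inner_L2_AE[OF L2_add[OF L] assms(3) Dstar_lincomb(2)[OF assms(1,2)]] 
      inner_L2_add_left[OF L assms(3)] by (simp add: inner_L2_cmult_left)
qed

lemma inner_lincomb_left:
  assumes "y \<in> L2 l" "z \<in> L2 l" "g \<in> L2 l"
  shows "inner_L2 l (\<lambda>x. y x + c * z x) g = inner_L2 l y g + c * inner_L2 l z g"
  using assms by (simp add: inner_L2_add_left L2_cmult inner_L2_cmult_left)

lemma inner_lincomb_right:
  assumes "y \<in> L2 l" "z \<in> L2 l" "g \<in> L2 l"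
  shows "inner_L2 l g (\<lambda>x. y x + c * z x) = inner_L2 l g y + cnj c * inner_L2 l g z"
  using assms by (simp add: inner_L2_add_right L2_cmult inner_L2_cmult_right)

section \<open>Compactly supported elements of the maximal domain\<close>

text \<open>
  Cutoffs are built from \<open>ramp 3\<close>, the first power for which the second derivative is still
  continuous.
\<close>

definition ramp :: "nat \<Rightarrow> real \<Rightarrow> real" where "ramp k x = max 0 x ^ k"

lemma DERIV_ramp:
  assumes "k \<ge> 1"
  shows "(ramp (Suc k) has_real_derivative real (Suc k) * ramp k x) (at x)"
proof -
  consider "x < 0" | "x = 0" | "x > 0" by linarith
  then show ?thesis
  proof cases
    case 1
    have "((\<lambda>x. 0) has_real_derivative 0) (at x)" by simp
    then have "(ramp (Suc k) has_real_derivative 0) (at x)"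
      by (rule has_field_derivative_transform_within_open[of _ _ _ "{..<0}"])
         (use 1 in \<open>auto simp: ramp_def max_def\<close>)
    then show ?thesis using 1 assms by (simp add: ramp_def max_def power_0_left)
  next
    case 2
    have "isCont (ramp k) 0" unfolding ramp_def by (intro continuous_intros)
    moreover have "ramp (Suc k) z - ramp (Suc k) 0 = ramp k z * (z - 0)" for z
      using assms by (auto simp: ramp_def max_def)
    moreover have "ramp k 0 = 0" using assms by (simp add: ramp_def)
    ultimately have "(ramp (Suc k) has_real_derivative 0) (at 0)"
      unfolding CARAT_DERIV by blast
    then show ?thesis using 2 assms by (simp add: ramp_def power_0_left)
  next
    case 3
    have "((\<lambda>x. x ^ Suc k) has_real_derivative real (Suc k) * x ^ k) (at x)"
      by (rule DERIV_power[OF DERIV_ident, THEN DERIV_cong]) simp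
    then have "(ramp (Suc k) has_real_derivative real (Suc k) * x ^ k) (at x)"
      by (rule has_field_derivative_transform_within_open[of _ _ _ "{0<..}"])
         (use 3 in \<open>auto simp: ramp_def max_def\<close>)
    then show ?thesis using 3 by (simp add: ramp_def)
  qed
qed

lemma jet_ramp:
  fixes l n :: real
  defines "t \<equiv> \<lambda>x. 1 - n * (x - l)"
  shows "jet l (\<lambda>x. of_real (ramp 3 (t x))) (\<lambda>x. of_real (- 3 * n * ramp 2 (t x)))
    (\<lambda>x. of_real (6 * n\<^sup>2 * ramp 1 (t x)))"
proof -
  have t: "(t has_real_derivative - n) (at x)" for x
    unfolding t_def by (auto intro!: derivative_eq_intros)
  have d: "((\<lambda>x. ramp (Suc k) (t x)) has_real_derivative real (Suc k) * ramp k (t x) * - n) (at x)"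
    if "k \<ge> 1" for k x
    by (rule DERIV_chain2[OF DERIV_ramp t]) fact
  have d2: "((\<lambda>x. ramp 3 (t x)) has_real_derivative - 3 * n * ramp 2 (t x)) (at x)" for x
    using d[of 2 x] by (simp add: eval_nat_numeral mult_ac)
  have d1: "((\<lambda>x. - 3 * n * ramp 2 (t x)) has_real_derivative 6 * n\<^sup>2 * ramp 1 (t x)) (at x)" for x
    using DERIV_cmult[OF d[of 1 x], of "- 3 * n"] by (simp add: eval_nat_numeral mult_ac)
  have v: "((\<lambda>x. complex_of_real (f x)) has_vector_derivative of_real (f' x)) (at x within S)"
    if "(f has_real_derivative f' x) (at x)" for f f' x S
    using that
    by (metis has_field_derivative_at_within has_real_derivative_iff_has_vector_derivative has_vector_derivative_of_real)
  show ?thesis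
    unfolding jet_def
  proof (intro conjI allI impI loc_abs_cont_with_C1 v d2 d1)
    show "continuous_on {l..b} (\<lambda>x. complex_of_real (6 * n\<^sup>2 * ramp 1 (t x)))" for b
      unfolding ramp_def t_def by (intro continuous_intros)
  qed
qed

text \<open>
  The same as \<open>solves\<close>, but with an explicit representative of the second derivative.
\<close>

definition solution_jet where
  "solution_jet l q z y y1 w \<longleftrightarrow> jet l y y1 w \<and>
     (AE x in lebesgue_on {l..}. - w x + complex_of_real (q x) * y x = z * y x)"

lemma solution_jet_lincomb:
  assumes "solution_jet l q z y y1 w" "solution_jet l q z v v1 u"
  shows "solution_jet l q z (\<lambda>x. a * y x + b * v x) (\<lambda>x. a * y1 x + b * v1 x) (\<lambda>x. a * w x + b * u x)"
proof -
  have "AE x in lebesgue_on {l..}. - (a * w x + b * u x) + complex_of_real (q x) * (a * y x + b * v x) = z * (a * y x + b * v x)"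
    using assms[unfolded solution_jet_def, THEN conjunct2]
  proof eventually_elim
    case (elim x)
    have "- (a * w x + b * u x) + complex_of_real (q x) * (a * y x + b * v x) =
      a * (- w x + complex_of_real (q x) * y x) + b * (- u x + complex_of_real (q x) * v x)"
      by (simp add: algebra_simps)
    then show ?case unfolding elim by (simp add: algebra_simps)
  qed
  then show ?thesis using assms by (auto simp: solution_jet_def intro: jet_add jet_cmult)
qed

lemma solves_solution_jet: "solves l q z y \<Longrightarrow> solution_jet l q z y (deriv1 l y) (deriv2 l y)"
  by (auto simp: solves_def solution_jet_def diff_expr_def intro: regular_fun_jet)

text \<open>
  The differential expression applied to \<open>ramp 3 (1 - n (x - l)) y(x)\<close> for a solution \<open>y\<close> at \<open>z\<close>:
  by the Leibniz rule the potential occurs only in the term \<open>z y\<close>.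
\<close>

definition cutoff_expr where
  "cutoff_expr l z n y y1 x =
     z * (of_real (ramp 3 (1 - n * (x - l))) * y x) - 2 * (of_real (- 3 * n * ramp 2 (1 - n * (x - l))) * y1 x)
     - of_real (6 * n\<^sup>2 * ramp 1 (1 - n * (x - l))) * y x"

lemma ramp_eq_0: "k \<ge> 1 \<Longrightarrow> t \<le> 0 \<Longrightarrow> ramp k t = 0"
  by (auto simp: ramp_def max_def)

text \<open>
  A potential that is merely locally summable need not map smooth functions to square-integrable
  ones, so compactly supported elements of \<open>Dstar\<close> are obtained by cutting off solutions: the
  potential is then absorbed by the equation and what remains is continuous with compact support.
\<close>

lemma cutoff_solution:
  assumes s: "solution_jet l q z y y1 w" and n: "n > 0"
    and \<eta>: "\<And>x. \<eta> x = of_real (ramp 3 (1 - n * (x - l))) * y x"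
  obtains \<eta>1 v where "jet l \<eta> \<eta>1 v" "\<eta> \<in> Dstar l q"
    "\<forall>x\<ge>l + 1 / n. \<eta> x = 0 \<and> \<eta>1 x = 0 \<and> v x = 0"
    "\<eta> l = y l" "\<eta>1 l = y1 l - 3 * of_real n * y l"
    "AE x in lebesgue_on {l..}. diff_expr l q \<eta> x = cutoff_expr l z n y y1 x"
    "cutoff_expr l z n y y1 \<in> L2 l"
proof -
  have \<eta>_def: "\<eta> = (\<lambda>x. of_real (ramp 3 (1 - n * (x - l))) * y x)"
    using \<eta> by blast
  define r where "r k x = complex_of_real (ramp k (1 - n * (x - l)))" for k x
  have r0: "r k x = 0" if "x \<ge> l + 1 / n" "k \<ge> 1" for x k
    unfolding r_def using that n by (subst ramp_eq_0) (auto simp: field_simps)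
  define \<eta>1 where "\<eta>1 x = of_real (- 3 * n * ramp 2 (1 - n * (x - l))) * y x + r 3 x * y1 x" for x
  define v where "v x = of_real (6 * n\<^sup>2 * ramp 1 (1 - n * (x - l))) * y x
     + 2 * (of_real (- 3 * n * ramp 2 (1 - n * (x - l))) * y1 x) + r 3 x * w x" for x
  have jy: "jet l y y1 w" using s by (simp add: solution_jet_def)
  have j: "jet l \<eta> \<eta>1 v"
    using jet_mult[OF jet_ramp[where l=l and n=n] jy] unfolding \<eta>_def \<eta>1_def v_def r_def .
  have r1: "of_real (6 * n\<^sup>2 * ramp 1 (1 - n * (x - l))) = 6 * of_real n ^ 2 * r 1 x"
    "of_real (- 3 * n * ramp 2 (1 - n * (x - l))) = - 3 * of_real n * r 2 x" for x
    by (auto simp: r_def)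
  have supp: "\<eta> x = 0 \<and> \<eta>1 x = 0 \<and> v x = 0" and e0: "cutoff_expr l z n y y1 x = 0"
    if "x \<ge> l + 1 / n" for x
    using r0[OF that] unfolding \<eta>_def \<eta>1_def v_def r1 cutoff_expr_def by (auto simp flip: r_def)
  have cy: "continuous_on {l..} y" "continuous_on {l..} y1"
    using jet_continuous[OF jy] jet_continuous1[OF jy] continuous_on_half_lineI by blast+
  have "continuous_on {l..} \<eta>" unfolding \<eta>_def ramp_def by (intro continuous_intros cy)
  then have L: "\<eta> \<in> L2 l" by (rule L2_compact_support[of _ _ "l + 1 / n"]) (use supp in auto)
  have "continuous_on {l..} (cutoff_expr l z n y y1)"
    unfolding cutoff_expr_def[abs_def] ramp_def by (intro continuous_intros cy)
  then have Le: "cutoff_expr l z n y y1 \<in> L2 l"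
    by (rule L2_compact_support[of _ _ "l + 1 / n"]) (use e0 in auto)
  have ae: "AE x in lebesgue_on {l..}. - v x + complex_of_real (q x) * \<eta> x = cutoff_expr l z n y y1 x"
    using s[unfolded solution_jet_def, THEN conjunct2]
  proof eventually_elim
    case (elim x)
    have "- v x + complex_of_real (q x) * \<eta> x = r 3 x * (- w x + complex_of_real (q x) * y x)
        - 2 * (of_real (- 3 * n * ramp 2 (1 - n * (x - l))) * y1 x)
     - of_real (6 * n\<^sup>2 * ramp 1 (1 - n * (x - l))) * y x"
      by (simp add: v_def \<eta>_def flip: r_def) (simp add: algebra_simps)
    then show ?case unfolding elim by (simp add: cutoff_expr_def r_def)
  qed
  show thesis
  proof (rule that[OF j])
    show "\<eta> \<in> Dstar l q" "AE x in lebesgue_on {l..}. diff_expr l q \<eta> x = cutoff_expr l z n y y1 x"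
      using DstarI[OF j L Le ae] by auto
    show "\<eta> l = y l" "\<eta>1 l = y1 l - 3 * of_real n * y l"
      by (simp_all add: \<eta>_def \<eta>1_def r_def ramp_def)
  qed (use supp Le in \<open>auto\<close>)
qed

section \<open>Green's identity\<close>

definition bracket where
  "bracket l y f = deriv1 l y l * cnj (f l) - y l * cnj (deriv1 l f l)"

text \<open>
  The failure of Green's identity, that is, the contribution of the endpoint at infinity.
\<close>

definition green_defect where
  "green_defect l q y f =
     inner_L2 l (diff_expr l q y) f - inner_L2 l y (diff_expr l q f) - bracket l y f"

lemma green_defect_lincomb_left:
  assumes "y \<in> Dstar l q" "z \<in> Dstar l q" "f \<in> Dstar l q"
  shows "green_defect l q (\<lambda>x. y x + c * z x) f = green_defect l q y f + c * green_defect l q z f"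
  using assms
  by (simp add: green_defect_def bracket_def inner_diff_expr_lincomb_left inner_lincomb_left DstarD
      Dstar_lincomb algebra_simps)

lemma green_defect_swap: "green_defect l q f y = - cnj (green_defect l q y f)"
  by (simp add: green_defect_def bracket_def inner_L2_cnj[of l f] inner_L2_cnj[of l "diff_expr l q f"])

lemma green_defect_lincomb_right:
  assumes "y \<in> Dstar l q" "z \<in> Dstar l q" "f \<in> Dstar l q"
  shows "green_defect l q f (\<lambda>x. y x + c * z x) = green_defect l q f y + cnj c * green_defect l q f z"
  by (subst (1 2 3) green_defect_swap) (simp add: green_defect_lincomb_left assms)

text \<open>
  The potential is real, hence cancels in \<open>L \<eta> cnj f - \<eta> cnj (L f)\<close>, where \<open>L\<close> is the differential
  expression; what remains is the derivative of \<open>\<eta> cnj f' - \<eta>' cnj f\<close>, which vanishes at \<open>b\<close>.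
\<close>

lemma green_compact_support:
  assumes j: "jet l \<eta> \<eta>1 v" and \<eta>: "\<eta> \<in> Dstar l q" and b: "l \<le> b"
    and supp: "\<And>x. b \<le> x \<Longrightarrow> \<eta> x = 0 \<and> \<eta>1 x = 0 \<and> v x = 0"
    and f: "f \<in> Dstar l q"
  shows "green_defect l q \<eta> f = 0"
proof -
  define K where "K x = \<eta> x * cnj (deriv2 l f x) - v x * cnj (f x)" for x
  have jf: "jet l f (deriv1 l f) (deriv2 l f)" using f by (rule Dstar_jet)
  note ac = loc_abs_cont_with_mult[OF jet_loc_abs_cont_with[OF j] loc_abs_cont_with_cnj]
    loc_abs_cont_with_mult[OF _ loc_abs_cont_with_cnj[OF jet_loc_abs_cont_with[OF jf]]]
  have "loc_abs_cont_with l (\<lambda>x. \<eta> x * cnj (deriv1 l f x) + - 1 * (\<eta>1 x * cnj (f x)))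
    (\<lambda>x. (\<eta>1 x * cnj (deriv1 l f x) + \<eta> x * cnj (deriv2 l f x)) +
       - 1 * (v x * cnj (f x) + \<eta>1 x * cnj (deriv1 l f x)))"
    using j jf by (intro loc_abs_cont_with_add loc_abs_cont_with_cmult ac) (auto simp: jet_def)
  then have "loc_abs_cont_with l (\<lambda>x. \<eta> x * cnj (deriv1 l f x) + - 1 * (\<eta>1 x * cnj (f x))) K"
    by (simp add: K_def[abs_def])
  from loc_abs_cont_withD[OF this b] supp[of b]
  have K: "(LINT x|lebesgue_on {l..b}. K x) = \<eta>1 l * cnj (f l) - \<eta> l * cnj (deriv1 l f l)"
    by simp
  have L: "diff_expr l q \<eta> \<in> L2 l" "\<eta> \<in> L2 l" "f \<in> L2 l" "diff_expr l q f \<in> L2 l"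
    using f \<eta> by (auto intro: DstarD)
  have i: "integrable (lebesgue_on {l..}) (\<lambda>x. diff_expr l q \<eta> x * cnj (f x) - \<eta> x * cnj (diff_expr l q f x))"
    using L by (intro Bochner_Integration.integrable_diff L2_integrable_mult)
  have ae: "AE x in lebesgue_on {l..}. diff_expr l q \<eta> x * cnj (f x) - \<eta> x * cnj (diff_expr l q f x) = K x"
    using jet_deriv2[OF j]
  proof eventually_elim
    case (elim x)
    then show ?case by (simp add: diff_expr_def K_def algebra_simps)
  qed
  have m: "K \<in> borel_measurable (lebesgue_on {l..})"
    by (rule borel_measurable_lebesgue_on_AE[OF _ _ ae]) (use i in auto)
  have "inner_L2 l (diff_expr l q \<eta>) f - inner_L2 l \<eta> (diff_expr l q f) =
    (LINT x|lebesgue_on {l..}. diff_expr l q \<eta> x * cnj (f x) - \<eta> x * cnj (diff_expr l q f x))"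
    unfolding inner_L2_def using L by (intro Bochner_Integration.integral_diff[symmetric] L2_integrable_mult)
  also have "\<dots> = (LINT x|lebesgue_on {l..}. K x)"
    using i m ae by (intro integral_cong_AE) auto
  also have "\<dots> = (LINT x|lebesgue_on {l..}. (if x \<in> {l..b} then K x else 0))"
    using supp by (intro Bochner_Integration.integral_cong) (auto simp: K_def)
  also have "\<dots> = (LINT x|lebesgue_on {l..b}. K x)"
    by (rule Lebesgue_Measure.integral_restrict) auto
  finally show ?thesis
    using K jet_deriv1[OF j, of l] by (simp add: green_defect_def bracket_def)
qed

lemma skew_form_eq_0I:
  assumes "s + t = (0::complex)" "\<i> * t - \<i> * s = 0"
  shows "s = 0"
proof -
  have "\<i> * (t - s) = 0" using assms(2) by (simp add: algebra_simps)
  then have "t = s" by simp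
  with assms(1) show ?thesis by simp
qed

text \<open>
  Polarization: the diagonal values at \<open>y + f\<close> and \<open>y + \<i> f\<close> determine the value at \<open>(y, f)\<close>.
\<close>

lemma green_defect_eq_0_of_diagonal:
  assumes "\<And>y. y \<in> Dstar l q \<Longrightarrow> green_defect l q y y = 0" 
    "y \<in> Dstar l q" "f \<in> Dstar l q"
  shows "green_defect l q y f = 0"
proof -
  have e: "cnj c * green_defect l q y f + c * green_defect l q f y = 0" for c
  proof -
    have "green_defect l q (\<lambda>x. y x + c * f x) (\<lambda>x. y x + c * f x) = 0"
      by (intro assms(1) Dstar_lincomb assms(2,3))
    then show ?thesis
      using assms by (simp add: green_defect_lincomb_left green_defect_lincomb_right Dstar_lincomb)
  qed
  show ?thesis
    by (rule skew_form_eq_0I[of _ "green_defect l q f y"]) (use e[of 1] e[of \<i>] in \<open>auto simp: algebra_simps\<close>)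
qed

locale nonneg_half_line =
  fixes l :: real and q :: "real \<Rightarrow> real" and m_inf :: "complex \<Rightarrow> complex"
  assumes nonneg: "nonneg_min_op l q"
    and weyl: "is_weyl_function l q m_inf"
begin

abbreviation "D \<equiv> Dstar l q"
abbreviation "L \<equiv> diff_expr l q"
abbreviation "inn \<equiv> inner_L2 l"
abbreviation "D1 y \<equiv> deriv1 l y l"

lemma solution_with_data:
  assumes "z \<notin> \<real>\<^sub>\<ge>\<^sub>0"
  obtains y y1 w where "solution_jet l q z y y1 w" "y l = a" "y1 l = b"
proof -
  from weyl assms obtain \<phi>1 \<phi>2 where s: "solves l q z \<phi>1" "solves l q z \<phi>2"
    and d: "\<phi>1 l = 0" "deriv1 l \<phi>1 l = 1" "\<phi>2 l = -1" "deriv1 l \<phi>2 l = 0"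
    unfolding is_weyl_function_def is_weyl_value_def by blast
  show thesis
    by (rule that[OF solution_jet_lincomb[OF s[THEN solves_solution_jet], where a=b and b="-a"]])
      (simp_all add: d)
qed

text \<open>
  The normalization is \<open>\<psi>(l) = -1\<close>, \<open>\<psi>'(l) = m\<^sub>\<infinity>(z)\<close>.
\<close>

lemma weyl_solution:
  assumes "z \<notin> \<real>\<^sub>\<ge>\<^sub>0"
  obtains \<psi> where "\<psi> \<in> D" "\<psi> l = -1" "D1 \<psi> = m_inf z"
    "AE x in lebesgue_on {l..}. L \<psi> x = z * \<psi> x"
proof -
  from weyl assms obtain \<phi>1 \<phi>2 where s: "solves l q z \<phi>2" "solves l q z \<phi>1"
    and d: "\<phi>1 l = 0" "deriv1 l \<phi>1 l = 1" "\<phi>2 l = -1" "deriv1 l \<phi>2 l = 0"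
    and L2: "(\<lambda>x. 1 * \<phi>2 x + m_inf z * \<phi>1 x) \<in> L2 l"
    unfolding is_weyl_function_def is_weyl_value_def by auto
  note j = solution_jet_lincomb[OF s[THEN solves_solution_jet], of 1 "m_inf z", unfolded solution_jet_def]
  from DstarI[OF conjunct1[OF j] L2 L2_cmult[OF L2] conjunct2[OF j]] jet_deriv1[OF conjunct1[OF j], of l]
  show thesis by (intro that[of "\<lambda>x. 1 * \<phi>2 x + m_inf z * \<phi>1 x"]) (auto simp: d)
qed

lemma minus_1_nonneg_Reals: "(- 1::complex) \<notin> \<real>\<^sub>\<ge>\<^sub>0"
  by (auto simp: complex_nonneg_Reals_iff)

text \<open>
  Subtracting from \<open>y\<close> a compactly supported \<open>\<eta>\<close> with the same boundary data leaves an element of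
  the minimal domain, whose defect vanishes because the minimal operator has a real quadratic form.
  Subtracting \<open>\<eta>\<close> does not change the defect.
\<close>

lemma green_defect_0:
  assumes "y \<in> D" "f \<in> D"
  shows "green_defect l q y f = 0"
proof (rule green_defect_eq_0_of_diagonal[OF _ assms])
  fix y assume y: "y \<in> D"
  \<comment> \<open>the cutoff has slope \<open>- 3\<close> at \<open>l\<close>; the data of \<open>u\<close> compensate for it\<close>
  obtain u u1 w where u: "solution_jet l q (-1) u u1 w" "u l = y l" "u1 l = D1 y + 3 * y l"
    by (rule solution_with_data[OF minus_1_nonneg_Reals])
  define \<eta> where "\<eta> x = of_real (ramp 3 (1 - 1 * (x - l))) * u x" for x
  obtain \<eta>1 v where e: "jet l \<eta> \<eta>1 v" "\<eta> \<in> D"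
    "\<forall>x\<ge>l + 1 / 1. \<eta> x = 0 \<and> \<eta>1 x = 0 \<and> v x = 0" "\<eta> l = u l"
    "\<eta>1 l = u1 l - 3 * of_real 1 * u l"
    "AE x in lebesgue_on {l..}. L \<eta> x = cutoff_expr l (-1) 1 u u1 x"
    "cutoff_expr l (-1) 1 u u1 \<in> L2 l"
    by (rule cutoff_solution[OF u(1) zero_less_one \<eta>_def])
  have d: "\<eta> l = y l" "D1 \<eta> = D1 y"
    using e(4,5) u(2,3) jet_deriv1[OF e(1), of l] by auto
  define s where "s = (\<lambda>x. y x + (- 1) * \<eta> x)"
  have sD: "s \<in> D" and sm: "s \<in> dom_min l q"
    using Dstar_lincomb(1,3)[OF y e(2), of "-1"] d by (auto simp: s_def dom_min_def)
  have "inn (L s) s \<in> \<real>\<^sub>\<ge>\<^sub>0" using nonneg sm by (auto simp: nonneg_min_op_def)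
  then obtain r where "inn (L s) s = complex_of_real r" by (auto elim: nonneg_Reals_cases)
  then have "inn (L s) s = inn s (L s)" by (simp add: inner_L2_cnj[of l s])
  then have "green_defect l q s s = 0"
    using sm by (simp add: green_defect_def bracket_def dom_min_def)
  moreover have c: "green_defect l q \<eta> f = 0" if "f \<in> D" for f
    using green_compact_support[OF e(1,2) _ _ that, of "l + 1 / 1"] e(3) by simp
  moreover have "green_defect l q s s = green_defect l q y s"
    unfolding s_def using c[OF sD[unfolded s_def]] green_defect_lincomb_left[OF y e(2) sD[unfolded s_def], of "-1"] by simp
  moreover have "green_defect l q y s = green_defect l q y y"
    unfolding s_def green_defect_lincomb_right[OF y e(2) y] 
    using c[OF y] by (subst (2) green_defect_swap) simp
  ultimately show "green_defect l q y y = 0" by simp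
qed

lemma green:
  assumes "y \<in> D" "f \<in> D"
  shows "inn (L y) f - inn y (L f) = D1 y * cnj (f l) - y l * cnj (D1 f)"
  using green_defect_0[OF assms] by (simp add: green_defect_def bracket_def)

end

section \<open>Changing the derivative at the endpoint at small cost\<close>

lemma integral_support_bound:
  fixes f :: "real \<Rightarrow> complex"
  assumes "integrable (lebesgue_on {l..}) f" "l \<le> b" "0 \<le> K"
    "\<And>x. x \<in> {l..b} \<Longrightarrow> norm (f x) \<le> K" "\<And>x. x > b \<Longrightarrow> f x = 0"
  shows "norm (LINT x|lebesgue_on {l..}. f x) \<le> K * (b - l)"
proof -
  have "integrable lebesgue (\<lambda>x. if x \<in> {l..} then f x else 0)"
    using assms(1) by (subst Lebesgue_Measure.integrable_restrict_UNIV) auto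
  moreover have "(\<lambda>x. if x \<in> {l..} then f x else 0) = (\<lambda>x. if x \<in> {l..b} then f x else 0)"
    using assms(5) by fastforce
  ultimately have "integrable lebesgue (\<lambda>x. if x \<in> {l..b} then f x else 0)" by simp
  then have i: "integrable (lebesgue_on {l..b}) f"
    by (subst (asm) Lebesgue_Measure.integrable_restrict_UNIV) auto
  have "(LINT x|lebesgue_on {l..}. f x) = (LINT x|lebesgue_on {l..}. (if x \<in> {l..b} then f x else 0))"
    using assms(5) by (intro Bochner_Integration.integral_cong) auto
  also have "\<dots> = (LINT x|lebesgue_on {l..b}. f x)"
    by (rule Lebesgue_Measure.integral_restrict) auto
  finally have "(f has_integral (LINT x|lebesgue_on {l..}. f x)) (cbox l b)"
    using has_integral_integral_lebesgue_on[OF i] by simp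
  from has_integral_bound[OF assms(3) this] assms(4) show ?thesis using assms(2) by simp
qed

text \<open>
  A linear form of the Cauchy-Schwarz inequality; the free parameter \<open>e\<close> replaces the square root.
\<close>

lemma norm_inner_L2_le:
  assumes "f \<in> L2 l" "g \<in> L2 l" "e > 0"
  shows "cmod (inner_L2 l f g) \<le> e * norm2_L2 l f + norm2_L2 l g / e"
proof -
  have "cmod (inner_L2 l f g) \<le> (LINT x|lebesgue_on {l..}. cmod (f x * cnj (g x)))"
    unfolding inner_L2_def by simp
  also have "\<dots> \<le> (LINT x|lebesgue_on {l..}. e * (cmod (f x))\<^sup>2 + (cmod (g x))\<^sup>2 / e)"
  proof (rule integral_mono)
    show "integrable (lebesgue_on {l..}) (\<lambda>x. cmod (f x * cnj (g x)))"
      using L2_integrable_mult[OF assms(1,2)] by (rule integrable_norm)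
    show "integrable (lebesgue_on {l..}) (\<lambda>x. e * (cmod (f x))\<^sup>2 + (cmod (g x))\<^sup>2 / e)"
      using assms by (auto simp: L2_def)
    fix x
    define a b where "a = cmod (f x)" and "b = cmod (g x)"
    have "0 \<le> (e * a - b)\<^sup>2 + e * (a * b)" using assms(3) by (simp add: a_def b_def)
    then have "e * (a * b) \<le> e * (e * a\<^sup>2 + b\<^sup>2 / e)"
      using assms(3) by (simp add: power2_eq_square algebra_simps)
    then have "a * b \<le> e * a\<^sup>2 + b\<^sup>2 / e" using assms(3) by simp
    then show "cmod (f x * cnj (g x)) \<le> e * (cmod (f x))\<^sup>2 + (cmod (g x))\<^sup>2 / e"
      by (simp add: norm_mult a_def b_def)
  qed
  also have "\<dots> = e * norm2_L2 l f + norm2_L2 l g / e"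
    using assms by (simp add: norm2_L2_def L2_def)
  finally show ?thesis .
qed

context nonneg_half_line begin

text \<open>
  Functions with boundary data \<open>(0, 1)\<close> that tend to zero both weakly with a rate and in energy. A
  solution \<open>y\<close> with these data satisfies \<open>|y(x)| \<le> C (x - l)\<close> near \<open>l\<close>, so its cutoff to an
  interval of length \<open>1/n\<close> is of size \<open>C/n\<close>, its image under the operator of size \<open>C n\<close>, and their
  product integrates to \<open>O(1/n)\<close>.
\<close>

lemma small_cutoffs:
  obtains C where "C \<ge> 0" 
    "\<And>n::real. n \<ge> 1 \<Longrightarrow> \<exists>\<eta>\<in>D. \<eta> l = 0 \<and> D1 \<eta> = 1 \<and>
       (\<forall>f\<in>L2 l. cmod (inn f \<eta>) \<le> (norm2_L2 l f + C) / n) \<and> cmod (inn (L \<eta>) \<eta>) \<le> C / n"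
proof -
  obtain y y1 w where s: "solution_jet l q (-1) y y1 w" and y0: "y l = 0" "y1 l = 1"
    by (rule solution_with_data[OF minus_1_nonneg_Reals])
  then have j: "jet l y y1 w" by (simp add: solution_jet_def)
  have "bounded (y1 ` {l..l+1})"
    by (intro compact_imp_bounded compact_continuous_image jet_continuous1[OF j]) simp
  then obtain C where C: "C > 0" "\<forall>z\<in>y1 ` {l..l+1}. norm z \<le> C"
    unfolding bounded_pos by auto
  then have y1: "norm (y1 x) \<le> C" if "x \<in> {l..l+1}" for x using that by blast
  have y: "norm (y x) \<le> C * (x - l)" if "x \<in> {l..l+1}" for x
  proof -
    have x: "l \<le> x" using that by simp
    have i: "(y1 has_integral y x - y l) (cbox l x)"
      using has_integral_integral_lebesgue_on[OF loc_abs_cont_withD(1)[OF jet_loc_abs_cont_with[OF j] x]]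
        loc_abs_cont_withD(2)[OF jet_loc_abs_cont_with[OF j] x] by simp
    have "norm (y x - y l) \<le> C * measure lborel (cbox l x)"
      by (rule has_integral_bound[OF _ i]) (use C that in \<open>auto intro!: y1\<close>)
    then show ?thesis using that by (simp add: y0)
  qed
  show thesis
  \<comment> \<open>13 = 1 + 6 + 6: the constant that bounds the three terms of the cutoff expression, see below\<close>
  proof (rule that[of "13 * C\<^sup>2"])
    show "0 \<le> 13 * C\<^sup>2" by simp
    fix n :: real assume n: "n \<ge> 1"
    then have n0: "n > 0" by simp
    define \<eta> where "\<eta> x = of_real (ramp 3 (1 - n * (x - l))) * y x" for x
    define g where "g = cutoff_expr l (-1) n y y1"
    obtain \<eta>1 v where e: "jet l \<eta> \<eta>1 v" "\<eta> \<in> D"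
      "\<forall>x\<ge>l + 1 / n. \<eta> x = 0 \<and> \<eta>1 x = 0 \<and> v x = 0"
      "\<eta> l = y l" "\<eta>1 l = y1 l - 3 * of_real n * y l"
      "AE x in lebesgue_on {l..}. L \<eta> x = g x" "g \<in> L2 l"
      unfolding g_def by (rule cutoff_solution[OF s n0 \<eta>_def])
    have g0: "g x = 0" if "x \<ge> l + 1 / n" for x
    proof -
      have "1 - n * (x - l) \<le> 0" using that n0 by (simp add: field_simps)
      then show ?thesis by (simp add: g_def cutoff_expr_def ramp_eq_0)
    qed
    have x1: "x \<in> {l..l+1}" "x - l \<le> 1 / n" if "x \<in> {l..l + 1/n}" for x
    proof -
      have "1 / n \<le> 1" using n by simp
      then show "x \<in> {l..l+1}" "x - l \<le> 1 / n" using that by auto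
    qed
    have r: "0 \<le> ramp k (1 - n * (x - l))" "ramp k (1 - n * (x - l)) \<le> 1" if "x \<in> {l..l + 1/n}" for x k
      using that n0 by (auto simp: ramp_def intro!: power_le_one)
    have yn: "norm (y x) \<le> C / n" if "x \<in> {l..l + 1/n}" for x
    proof -
      have "norm (y x) \<le> C * (x - l)" using y x1[OF that] by blast
      also have "\<dots> \<le> C * (1 / n)" using C x1[OF that] by (intro mult_left_mono) auto
      finally show ?thesis by simp
    qed
    have en: "norm (\<eta> x) \<le> C / n" if "x \<in> {l..l + 1/n}" for x
    proof -
      have "norm (\<eta> x) \<le> 1 * norm (y x)"
        unfolding \<eta>_def norm_mult using r[OF that, of 3] by (intro mult_right_mono) auto
      then show ?thesis using yn[OF that] by simp
    qed
    have gn: "norm (g x) \<le> 13 * C * n" if "x \<in> {l..l + 1/n}" for x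
    proof -
      define r1 r2 where "r1 = ramp 1 (1 - n * (x - l))" and "r2 = ramp 2 (1 - n * (x - l))"
      have r12: "0 \<le> r1" "r1 \<le> 1" "0 \<le> r2" "r2 \<le> 1" using r[OF that] by (auto simp: r1_def r2_def)
      have "g x = - \<eta> x + of_real (6 * n * r2) * y1 x - of_real (6 * n\<^sup>2 * r1) * y x"
        by (simp add: g_def cutoff_expr_def \<eta>_def r1_def r2_def)
      then have "norm (g x) \<le> norm (\<eta> x) + norm (of_real (6 * n * r2) * y1 x) + norm (of_real (6 * n\<^sup>2 * r1) * y x)"
        using norm_triangle_ineq4[of "- \<eta> x + of_real (6 * n * r2) * y1 x" "of_real (6 * n\<^sup>2 * r1) * y x"]
          norm_triangle_ineq[of "- \<eta> x" "of_real (6 * n * r2) * y1 x"] by simp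
      also have "\<dots> = norm (\<eta> x) + 6 * n * r2 * norm (y1 x) + 6 * n\<^sup>2 * r1 * norm (y x)"
        using r12 n0 by (simp add: norm_mult norm_power)
      also have "\<dots> \<le> C / n + (6 * n * 1) * C + (6 * n\<^sup>2 * 1) * (C / n)"
        using r12 n0 C by (intro add_mono mult_mono en[OF that] y1 yn[OF that] x1[OF that] mult_nonneg_nonneg) auto
      also have "\<dots> = C / n + 12 * C * n" using n0 by (simp add: power2_eq_square field_simps)
      also have "C / n \<le> C * n"
      proof -
        have "C / n \<le> C / 1" using n C by (intro divide_left_mono) auto
        also have "\<dots> \<le> C * n" using n C by simp
        finally show ?thesis .
      qed
      finally show ?thesis by simp
    qed
    have L\<eta>: "\<eta> \<in> L2 l" using e(2) by (rule DstarD)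
    have n2: "norm2_L2 l \<eta> \<le> (C / n)\<^sup>2 * (1 / n)"
    proof -
      have "norm (LINT x|lebesgue_on {l..}. \<eta> x * cnj (\<eta> x)) \<le> (C / n)\<^sup>2 * (l + 1 / n - l)"
      proof (rule integral_support_bound)
        show "cmod (\<eta> x * cnj (\<eta> x)) \<le> (C / n)\<^sup>2" if "x \<in> {l..l + 1 / n}" for x
          using power_mono[OF en[OF that], of 2] by (simp add: norm_mult power2_eq_square)
      qed (use n0 e(3) L2_integrable_mult[OF L\<eta> L\<eta>] in auto)
      then have "norm (inn \<eta> \<eta>) \<le> (C / n)\<^sup>2 * (1 / n)" by (simp add: inner_L2_def)
      then show ?thesis using norm2_L2_nonneg[of l \<eta>] by (simp add: inner_L2_self)
    qed
    have "inn (L \<eta>) \<eta> = inn g \<eta>"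
      by (rule inner_L2_AE[OF e(7) L\<eta> e(6)]) simp
    also have "norm \<dots> \<le> (13 * C * n * (C / n)) * (l + 1 / n - l)"
      unfolding inner_L2_def
    proof (rule integral_support_bound)
      show "cmod (g x * cnj (\<eta> x)) \<le> 13 * C * n * (C / n)" if "x \<in> {l..l + 1 / n}" for x
        unfolding norm_mult complex_mod_cnj using C n0 by (intro mult_mono gn[OF that] en[OF that]) auto
    qed (use n0 C e(3) g0 L2_integrable_mult[OF e(7) L\<eta>] in auto)
    finally have b2: "norm (inn (L \<eta>) \<eta>) \<le> 13 * C\<^sup>2 / n" using n0 by (simp add: power2_eq_square)
    have b1: "cmod (inn f \<eta>) \<le> (norm2_L2 l f + 13 * C\<^sup>2) / n" if "f \<in> L2 l" for f
    proof -
      have "cmod (inn f \<eta>) \<le> 1 / n * norm2_L2 l f + norm2_L2 l \<eta> / (1 / n)"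
        using n0 by (intro norm_inner_L2_le that L\<eta>) auto
      also have "\<dots> \<le> 1 / n * norm2_L2 l f + ((C / n)\<^sup>2 * (1 / n)) / (1 / n)"
        using n0 by (intro add_left_mono divide_right_mono n2) auto
      also have "\<dots> = 1 / n * norm2_L2 l f + C\<^sup>2 / n * (1 / n)"
        using n0 by (simp add: power2_eq_square)
      also have "\<dots> \<le> 1 / n * norm2_L2 l f + C\<^sup>2 / n * 1"
        using n by (intro add_left_mono mult_left_mono) auto
      also have "1 / n * norm2_L2 l f + C\<^sup>2 / n * 1 \<le> (norm2_L2 l f + 13 * C\<^sup>2) / n"
        using n0 by (simp add: field_simps)
      finally show ?thesis by simp
    qed
    show "\<exists>\<eta>\<in>D. \<eta> l = 0 \<and> D1 \<eta> = 1 \<and>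
       (\<forall>f\<in>L2 l. cmod (inn f \<eta>) \<le> (norm2_L2 l f + 13 * C\<^sup>2) / n) \<and> cmod (inn (L \<eta>) \<eta>) \<le> 13 * C\<^sup>2 / n"
      using b1 b2 e(2,4,5) jet_deriv1[OF e(1), of l] y0 by (intro bexI[of _ \<eta>]) auto
  qed
qed

end

section \<open>The energy form and its infimum\<close>

context nonneg_half_line begin

text \<open>
  Formally \<open>\<integral> |y'|\<^sup>2 + q |y|\<^sup>2\<close>; the boundary term makes it independent of any boundary condition
  at \<open>l\<close>.
\<close>

definition energy :: "(real \<Rightarrow> complex) \<Rightarrow> real" where
  "energy y = Re (inn (L y) y - D1 y * cnj (y l))"

text \<open>
  If \<open>v(l) = 0\<close>, then by Green's identity the cross term of the energy form is \<open>(L u, v)\<close>, without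
  \<open>u'(l)\<close> or \<open>v'(l)\<close>. It is therefore small whenever \<open>v\<close> is small in the Hilbert space.
\<close>

lemma energy_add_vanishing:
  assumes u: "u \<in> D" and v: "v \<in> D" and v0: "v l = 0"
  shows "energy (\<lambda>x. u x + c * v x) =
    energy u + 2 * Re (cnj c * inn (L u) v) + (cmod c)\<^sup>2 * Re (inn (L v) v)"
proof -
  let ?f = "\<lambda>x. u x + c * v x"
  have L2: "u \<in> L2 l" "v \<in> L2 l" "L u \<in> L2 l" "L v \<in> L2 l" "(\<lambda>x. c * v x) \<in> L2 l"
    using u v by (auto intro: DstarD L2_cmult)
  have f: "?f \<in> D" "D1 ?f = D1 u + c * D1 v" using Dstar_lincomb[OF u v] by auto
  have "inn (L ?f) ?f = inn (L u) ?f + c * inn (L v) ?f"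
    by (rule inner_diff_expr_lincomb_left[OF u v DstarD(1)[OF f(1)]])
  also have "inn (L u) ?f = inn (L u) u + cnj c * inn (L u) v"
    by (rule inner_lincomb_right) (use L2 in auto)
  also have "inn (L v) ?f = inn (L v) u + cnj c * inn (L v) v"
    by (rule inner_lincomb_right) (use L2 in auto)
  also have "inn (L v) u = cnj (inn (L u) v) + D1 v * cnj (u l)"
    using green[OF v u] v0 inner_L2_cnj[of l v "L u"] by (simp add: algebra_simps)
  finally have "inn (L ?f) ?f - D1 ?f * cnj (?f l) =
     (inn (L u) u - D1 u * cnj (u l)) + (cnj c * inn (L u) v + cnj (cnj c * inn (L u) v)) + (c * cnj c) * inn (L v) v"
    using v0 f by (simp add: algebra_simps)
  then show ?thesis
    unfolding energy_def complex_norm_square[symmetric] complex_add_cnj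
    by (simp flip: of_real_power)
qed

text \<open>
  The energy form does not control the derivative at the endpoint.
\<close>

lemma energy_change_derivative:
  assumes u: "u \<in> D" and e: "e > 0"
  obtains f where "f \<in> D" "f l = u l" "D1 f = d" "\<bar>energy f - energy u\<bar> < e"
proof -
  obtain C where C: "C \<ge> 0" "\<And>n::real. n \<ge> 1 \<Longrightarrow> \<exists>\<eta>\<in>D. \<eta> l = 0 \<and> D1 \<eta> = 1 \<and>
       (\<forall>f\<in>L2 l. cmod (inn f \<eta>) \<le> (norm2_L2 l f + C) / n) \<and> cmod (inn (L \<eta>) \<eta>) \<le> C / n"
    using small_cutoffs by blast
  define c where "c = d - D1 u"
  define K where "K = 2 * cmod c * (norm2_L2 l (L u) + C) + (cmod c)\<^sup>2 * C"
  have K: "K \<ge> 0" using C norm2_L2_nonneg by (simp add: K_def)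
  define n where "n = max 1 (K / e + 1)"
  have n: "n \<ge> 1" "n > K / e" by (auto simp: n_def)
  from C(2)[OF n(1)] obtain v where v: "v \<in> D" "v l = 0" "D1 v = 1"
    and b: "\<And>f. f \<in> L2 l \<Longrightarrow> cmod (inn f v) \<le> (norm2_L2 l f + C) / n" "cmod (inn (L v) v) \<le> C / n"
    by blast
  have b1: "\<bar>Re (cnj c * inn (L u) v)\<bar> \<le> cmod c * ((norm2_L2 l (L u) + C) / n)"
  proof -
    have "\<bar>Re (cnj c * inn (L u) v)\<bar> \<le> cmod (cnj c * inn (L u) v)" by (rule abs_Re_le_cmod)
    also have "\<dots> \<le> cmod c * ((norm2_L2 l (L u) + C) / n)"
      unfolding norm_mult complex_mod_cnj using u by (intro mult_left_mono b(1) DstarD) auto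
    finally show ?thesis .
  qed
  have b2: "\<bar>(cmod c)\<^sup>2 * Re (inn (L v) v)\<bar> \<le> (cmod c)\<^sup>2 * (C / n)"
    unfolding abs_mult abs_power2 using order_trans[OF abs_Re_le_cmod b(2)] by (intro mult_left_mono) auto
  have "\<bar>energy u + 2 * x + y - energy u\<bar> \<le> 2 * a + b" if "\<bar>x\<bar> \<le> a" "\<bar>y\<bar> \<le> b" for x y a b :: real
    using that by linarith
  note le = this[OF b1 b2, folded energy_add_vanishing[OF u v(1,2)]]
  have "2 * (cmod c * ((norm2_L2 l (L u) + C) / n)) + (cmod c)\<^sup>2 * (C / n) = K / n"
    using n(1) by (simp add: K_def field_simps)
  with le have "\<bar>energy (\<lambda>x. u x + c * v x) - energy u\<bar> \<le> K / n" by (simp only:)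
  also have "\<dots> < e" using n e K by (simp add: field_simps)
  finally show thesis
    using Dstar_lincomb(1,3)[OF u v(1), of c] v by (intro that[of "\<lambda>x. u x + c * v x"]) (auto simp: c_def)
qed

text \<open>
  The Dirichlet extension is the Friedrichs extension: elements of its domain are limits, in the
  energy form, of elements of the minimal domain.
\<close>

lemma energy_dirichlet_nonneg:
  assumes "u \<in> D" "u l = 0"
  shows "energy u \<ge> 0"
proof (rule field_le_epsilon)
  fix e :: real assume "e > 0"
  then obtain f where f: "f \<in> D" "f l = u l" "D1 f = 0" "\<bar>energy f - energy u\<bar> < e"
    using energy_change_derivative[OF assms(1)] by blast
  then have "f \<in> dom_min l q" using assms by (simp add: dom_min_def)
  then have "inn (L f) f \<in> \<real>\<^sub>\<ge>\<^sub>0" using nonneg by (simp add: nonneg_min_op_def)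
  then have "energy f \<ge> 0" using f by (simp add: energy_def complex_nonneg_Reals_iff)
  then show "0 \<le> energy u + e" using f by linarith
qed

lemma negative_real_not_nonneg_Reals: "t < 0 \<Longrightarrow> complex_of_real t \<notin> \<real>\<^sub>\<ge>\<^sub>0"
  by (auto simp: complex_nonneg_Reals_iff)

lemma inner_L_eigen_left:
  assumes "\<psi> \<in> D" "AE x in lebesgue_on {l..}. L \<psi> x = z * \<psi> x" "f \<in> L2 l"
  shows "inn (L \<psi>) f = z * inn \<psi> f"
  using inner_L2_AE[OF L2_cmult[OF DstarD(1)[OF assms(1)]] assms(3) assms(2), of f]
  by (simp add: inner_L2_cmult_left)

lemma inner_L_eigen_right:
  assumes "\<psi> \<in> D" "AE x in lebesgue_on {l..}. L \<psi> x = z * \<psi> x" "f \<in> L2 l"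
  shows "inn f (L \<psi>) = cnj z * inn f \<psi>"
  using inner_L_eigen_left[OF assms] inner_L2_cnj[of l f] by simp

text \<open>
  Completing the square: for the form \<open>Q(f) - t \<parallel>f\<parallel>\<^sup>2\<close>, the Weyl solution at \<open>t\<close> is orthogonal to
  all functions vanishing at \<open>l\<close>, and its own value is \<open>m\<^sub>\<infinity>(t)\<close>.
\<close>

lemma energy_weyl_decomposition:
  assumes t: "t < 0" and f: "f \<in> D"
  obtains g where "g \<in> D" "g l = 0"
    "energy f = (cmod (f l))\<^sup>2 * Re (m_inf (of_real t)) + t * norm2_L2 l f + (energy g - t * norm2_L2 l g)"
proof -
  obtain \<psi> where \<psi>: "\<psi> \<in> D" "\<psi> l = -1" "D1 \<psi> = m_inf (of_real t)"
    "AE x in lebesgue_on {l..}. L \<psi> x = of_real t * \<psi> x"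
    using weyl_solution[OF negative_real_not_nonneg_Reals[OF t]] by blast
  define a where "a = f l"
  define g where "g x = f x + a * \<psi> x" for x
  have g: "g \<in> D" "D1 g = D1 f + a * m_inf (of_real t)" "g l = 0"
    using Dstar_lincomb(1,3)[OF f \<psi>(1), of a] \<psi> by (auto simp: g_def[abs_def] a_def)
  have f_eq: "f = (\<lambda>x. g x + (- a) * \<psi> x)" by (simp add: g_def)
  have L2: "g \<in> L2 l" "\<psi> \<in> L2 l" "f \<in> L2 l" "L g \<in> L2 l" using g \<psi> f by (auto intro: DstarD)
  have ff: "inn f f = inn g f + (- a) * inn \<psi> f"
    using inner_lincomb_left[OF L2(1,2,3), of "- a"] unfolding f_eq[symmetric] .
  have "inn (L f) f = inn (L g) f + (- a) * inn (L \<psi>) f"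
    using inner_diff_expr_lincomb_left[OF g(1) \<psi>(1) L2(3), of "- a"] unfolding f_eq[symmetric] .
  also have "inn (L \<psi>) f = of_real t * inn \<psi> f"
    by (rule inner_L_eigen_left[OF \<psi>(1,4) L2(3)])
  also have "(- a) * (of_real t * inn \<psi> f) = of_real t * (inn f f - inn g f)"
    unfolding ff by (simp add: algebra_simps)
  also have "inn g f = inn g g - cnj a * inn g \<psi>"
    using inner_lincomb_right[OF L2(1,2,1), of "- a"] unfolding f_eq[symmetric] by simp
  also have "inn (L g) f = inn (L g) g - cnj a * inn (L g) \<psi>"
    using inner_lincomb_right[OF L2(1,2,4), of "- a"] unfolding f_eq[symmetric] by simp
  also have "inn (L g) \<psi> = of_real t * inn g \<psi> - D1 g"
    using green[OF g(1) \<psi>(1)] inner_L_eigen_right[OF \<psi>(1,4) L2(1)] \<psi> g by (simp add: algebra_simps)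
  finally have "inn (L f) f - D1 f * cnj a =
      (inn (L g) g - D1 g * cnj (g l)) + of_real t * (inn f f - inn g g) + (a * cnj a) * m_inf (of_real t)"
    using g by (simp add: algebra_simps)
  then have "energy f = energy g + t * (norm2_L2 l f - norm2_L2 l g) + (cmod a)\<^sup>2 * Re (m_inf (of_real t))"
    unfolding energy_def complex_norm_square[symmetric] inner_L2_self a_def
    by (simp flip: of_real_power of_real_diff)
  then show thesis using g by (intro that[of g]) (auto simp: a_def algebra_simps)
qed

lemma energy_ge_weyl:
  assumes "t < 0" "f \<in> D"
  shows "(cmod (f l))\<^sup>2 * Re (m_inf (of_real t)) + t * norm2_L2 l f \<le> energy f"
proof -
  obtain g where g: "g \<in> D" "g l = 0"
    "energy f = (cmod (f l))\<^sup>2 * Re (m_inf (of_real t)) + t * norm2_L2 l f + (energy g - t * norm2_L2 l g)"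
    by (rule energy_weyl_decomposition[OF assms])
  have "energy g \<ge> 0" using g energy_dirichlet_nonneg by blast
  moreover have "t * norm2_L2 l g \<le> 0" using assms(1) norm2_L2_nonneg[of l g] by (simp add: mult_nonpos_nonneg)
  ultimately show ?thesis using g(3) by linarith
qed

end

locale nonneg_half_line_limit = nonneg_half_line +
  fixes m :: real
  assumes m: "((\<lambda>t::real. m_inf (complex_of_real t)) \<longlongrightarrow> complex_of_real m) (at_left 0)"
begin

lemma energy_ge:
  assumes f: "f \<in> D"
  shows "(cmod (f l))\<^sup>2 * m \<le> energy f"
proof (rule tendsto_upperbound)
  show "((\<lambda>t. (cmod (f l))\<^sup>2 * Re (m_inf (of_real t)) + t * norm2_L2 l f) \<longlongrightarrow>
      (cmod (f l))\<^sup>2 * m) (at_left 0)"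
  proof -
    have "((\<lambda>t. (cmod (f l))\<^sup>2 * Re (m_inf (of_real t)) + t * norm2_L2 l f) \<longlongrightarrow>
      (cmod (f l))\<^sup>2 * Re (complex_of_real m) + 0 * norm2_L2 l f) (at_left 0)"
      by (intro tendsto_intros tendsto_Re[OF m])
    then show ?thesis by simp
  qed
  show "\<forall>\<^sub>F t in at_left 0. (cmod (f l))\<^sup>2 * Re (m_inf (of_real t)) + t * norm2_L2 l f \<le> energy f"
  proof -
    have "\<forall>\<^sub>F t::real in at_left 0. t < 0" by (simp add: eventually_at_filter)
    then show ?thesis by eventually_elim (rule energy_ge_weyl[OF _ f])
  qed
qed simp

text \<open>
  The Weyl solution at \<open>t\<close> has energy \<open>m\<^sub>\<infinity>(t) + t \<parallel>\<psi>\<parallel>\<^sup>2 \<le> m\<^sub>\<infinity>(t)\<close>; a change of its derivative at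
  \<open>l\<close> costs arbitrarily little. Together with \<open>energy_ge\<close> this identifies the infimum under both
  boundary conditions as \<open>m\<close>.
\<close>

lemma energy_infimum:
  assumes e: "e > 0"
  obtains f where "f \<in> D" "f l = -1" "D1 f = d" "energy f < m + e"
proof -
  have "\<forall>\<^sub>F t in at_left 0. Re (m_inf (complex_of_real t)) < m + e / 2"
    using tendsto_Re[OF m] e by (intro order_tendstoD) auto
  moreover have "\<forall>\<^sub>F t::real in at_left 0. t < 0" by (simp add: eventually_at_filter)
  ultimately have "\<forall>\<^sub>F t in at_left 0. t < 0 \<and> Re (m_inf (complex_of_real t)) < m + e / 2"
    by eventually_elim simp
  then obtain t where t: "t < 0" "Re (m_inf (complex_of_real t)) < m + e / 2"
    using eventually_happens'[OF trivial_limit_at_left_real] by blast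
  obtain \<psi> where \<psi>: "\<psi> \<in> D" "\<psi> l = -1" "D1 \<psi> = m_inf (of_real t)"
    "AE x in lebesgue_on {l..}. L \<psi> x = of_real t * \<psi> x"
    using weyl_solution[OF negative_real_not_nonneg_Reals[OF t(1)]] by blast
  have "inn (L \<psi>) \<psi> = of_real (t * norm2_L2 l \<psi>)"
    using inner_L_eigen_left[OF \<psi>(1,4) DstarD(1)[OF \<psi>(1)]] by (simp add: inner_L2_self)
  then have "energy \<psi> = t * norm2_L2 l \<psi> + Re (m_inf (of_real t))"
    by (simp add: energy_def \<psi>)
  moreover have "t * norm2_L2 l \<psi> \<le> 0" using t norm2_L2_nonneg[of l \<psi>] by (simp add: mult_nonpos_nonneg)
  ultimately have "energy \<psi> < m + e / 2" using t by linarith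
  moreover obtain f where "f \<in> D" "f l = \<psi> l" "D1 f = d" "\<bar>energy f - energy \<psi>\<bar> < e / 2"
    by (rule energy_change_derivative[OF \<psi>(1) half_gt_zero[OF e]])
  ultimately show thesis using \<psi>(2) by (intro that[of f]) (simp, simp, simp, linarith)
qed

section \<open>The exact angle of sectoriality\<close>

lemma quadratic_form_T:
  assumes "f \<in> dom_T l q h"
  shows "Re (inn (L f) f) = energy f + Re h * (cmod (f l))\<^sup>2"
    and "Im (inn (L f) f) = Im h * (cmod (f l))\<^sup>2"
proof -
  have f: "f \<in> D" "D1 f = h * f l" using assms by (auto simp: dom_T_def)
  have n: "f l * cnj (f l) = complex_of_real ((cmod (f l))\<^sup>2)" by (simp only: complex_norm_square)
  have b: "D1 f * cnj (f l) = h * complex_of_real ((cmod (f l))\<^sup>2)"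
    unfolding f(2) n[symmetric] by (simp add: mult.assoc)
  show "Re (inn (L f) f) = energy f + Re h * (cmod (f l))\<^sup>2"
    by (simp add: energy_def b del: of_real_power)
  have "inn (L f) f - cnj (inn (L f) f) = h * complex_of_real ((cmod (f l))\<^sup>2) - cnj (h * complex_of_real ((cmod (f l))\<^sup>2))"
    using green[OF f(1,1)] inner_L2_cnj[of l f "L f"] b by (metis complex_cnj_cnj complex_cnj_mult mult.commute)
  then have "Im (inn (L f) f - cnj (inn (L f) f)) = Im (h * complex_of_real ((cmod (f l))\<^sup>2) - cnj (h * complex_of_real ((cmod (f l))\<^sup>2)))"
    by (rule arg_cong)
  then show "Im (inn (L f) f) = Im h * (cmod (f l))\<^sup>2" by (simp del: of_real_power)
qed

lemma zero_in_dom_T: "(\<lambda>x. 0) \<in> dom_T l q h"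
proof -
  have j: "jet l (\<lambda>x. 0) (\<lambda>x. 0) (\<lambda>x. 0)" by (simp add: jet_def loc_abs_cont_with_def)
  have z: "(\<lambda>x. 0) \<in> L2 l" by (simp add: L2_def)
  show ?thesis
    using DstarI(1)[OF j z z, of q] jet_deriv1[OF j, of l] by (simp add: dom_T_def)
qed

text \<open>
  With \<open>p = Re h + m\<close>, which is positive in both directions, the values of \<open>|Im (T\<^sub>h f, f)| / Re
  (T\<^sub>h f, f)\<close> are at most \<open>Im h / p\<close> and come arbitrarily close to it. So the inequality with \<open>cot
  \<beta>\<close> gives \<open>cot \<beta> Im h \<le> p\<close>, and exactness gives the converse.
\<close>

lemma sectorial_iff:
  assumes h: "Im h > 0"
  shows "sectorial inn (dom_T l q h) L \<beta> \<longleftrightarrow>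
    0 < \<beta> \<and> \<beta> < pi / 2 \<and> Re h + m = cot \<beta> * Im h"
proof -
  define p where "p = Re h + m"
  define ratio where "ratio f = \<bar>Im (inn (L f) f)\<bar> / Re (inn (L f) f)" for f
  have Re_ge: "p * (cmod (f l))\<^sup>2 \<le> Re (inn (L f) f)" if "f \<in> dom_T l q h" for f
    using energy_ge[of f] quadratic_form_T(1)[OF that] that by (simp add: p_def algebra_simps dom_T_def)
  have Im_eq: "\<bar>Im (inn (L f) f)\<bar> = Im h * (cmod (f l))\<^sup>2" if "f \<in> dom_T l q h" for f
    using quadratic_form_T(2)[OF that] h by (simp add: abs_mult)
  have near: "\<exists>f\<in>dom_T l q h. f l = -1 \<and> Re (inn (L f) f) < p + e" if "e > 0" for e
  proof -
    obtain f where f: "f \<in> D" "f l = -1" "D1 f = - h" "energy f < m + e"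
      by (rule energy_infimum[OF \<open>e > 0\<close>])
    then have "f \<in> dom_T l q h" by (simp add: dom_T_def)
    then show ?thesis using f quadratic_form_T(1)[of f h] by (intro bexI[of _ f]) (auto simp: p_def)
  qed
  have ratio_le: "ratio f \<le> Im h / p" if "f \<in> dom_T l q h" "p > 0" for f
  proof (cases "f l = 0")
    case True
    then show ?thesis using Im_eq[OF that(1)] h that(2) by (simp add: ratio_def)
  next
    case False
    then have pos: "(cmod (f l))\<^sup>2 > 0" by simp
    have "ratio f \<le> Im h * (cmod (f l))\<^sup>2 / (p * (cmod (f l))\<^sup>2)"
      unfolding ratio_def Im_eq[OF that(1)]
      using Re_ge[OF that(1)] less_le_trans[OF mult_pos_pos[OF that(2) pos] Re_ge[OF that(1)]] pos that(2) h
      by (intro divide_left_mono mult_pos_pos) auto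
    then show ?thesis using pos by simp
  qed
  show ?thesis
  proof safe
    assume s: "sectorial inn (dom_T l q h) L \<beta>"
    then show b: "0 < \<beta>" "\<beta> < pi / 2" by (auto simp: sectorial_def)
    have tan: "tan \<beta> > 0" using b by (simp add: tan_gt_zero)
    then have cot: "cot \<beta> > 0" "cot \<beta> * tan \<beta> = 1" by (auto simp: cot_altdef)
    have "cot \<beta> * Im h \<le> p + e" if e: "e > 0" for e
    proof -
      obtain f where f: "f \<in> dom_T l q h" "f l = -1" "Re (inn (L f) f) < p + e" using near[OF e] by blast
      have "cot \<beta> * \<bar>Im (inn (L f) f)\<bar> \<le> Re (inn (L f) f)" using s f by (simp add: sectorial_def)
      then show ?thesis using f Im_eq[OF f(1)] by simp
    qed
    then have 1: "cot \<beta> * Im h \<le> p" by (rule field_le_epsilon)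
    moreover have "0 < cot \<beta> * Im h" using cot h by simp
    ultimately have p: "p > 0" by linarith
    have "tan \<beta> = (SUP f\<in>dom_T l q h. ratio f)" using s by (simp add: sectorial_def ratio_def)
    also have "\<dots> \<le> Im h / p"
      using zero_in_dom_T by (intro cSUP_least ratio_le p) auto
    finally have "tan \<beta> * p \<le> Im h" using p by (simp add: field_simps)
    then have "cot \<beta> * (tan \<beta> * p) \<le> cot \<beta> * Im h" using cot by (intro mult_left_mono) auto
    then have "p \<le> cot \<beta> * Im h" using cot(2) by (simp flip: mult.assoc)
    with 1 show "Re h + m = cot \<beta> * Im h" by (simp add: p_def)
  next
    assume b: "0 < \<beta>" "\<beta> < pi / 2" and eq: "Re h + m = cot \<beta> * Im h"
    have tan: "tan \<beta> > 0" using b by (simp add: tan_gt_zero)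
    then have cot: "cot \<beta> > 0" "cot \<beta> * tan \<beta> = 1" by (auto simp: cot_altdef)
    have p_eq: "p = cot \<beta> * Im h" using eq by (simp add: p_def)
    then have p: "p > 0" using cot h by simp
    have tan_eq: "tan \<beta> = Im h / p" using cot h by (simp add: p_eq field_simps)
    have bdd: "bdd_above (ratio ` dom_T l q h)"
      using ratio_le p by (intro bdd_aboveI[of _ "Im h / p"]) auto
    define s where "s = (SUP f\<in>dom_T l q h. ratio f)"
    have up: "ratio f \<le> s" if "f \<in> dom_T l q h" for f
      unfolding s_def by (rule cSUP_upper[OF that bdd])
    \<comment> \<open>the zero function contributes the ratio 0 / 0 = 0\<close>
    have s0: "s \<ge> 0" using up[OF zero_in_dom_T] Im_eq[OF zero_in_dom_T[of h]] by (simp add: ratio_def)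
    have "Im h \<le> s * p + e" if e: "e > 0" for e
    proof -
      have "e / (s + 1) > 0" using e s0 by simp
      then obtain f where f: "f \<in> dom_T l q h" "f l = -1" "Re (inn (L f) f) < p + e / (s + 1)" using near by blast
      have pos: "Re (inn (L f) f) > 0" using Re_ge[OF f(1)] f(2) p by simp
      have "Im h = ratio f * Re (inn (L f) f)" using pos Im_eq[OF f(1)] f(2) by (simp add: ratio_def)
      also have "\<dots> \<le> s * (p + e / (s + 1))"
        using up[OF f(1)] f(3) pos s0 by (intro mult_mono) auto
      also have "\<dots> \<le> s * p + e" using e s0 by (simp add: field_simps)
      finally show ?thesis .
    qed
    then have "Im h \<le> s * p" by (rule field_le_epsilon)
    then have "tan \<beta> \<le> s" unfolding tan_eq using p by (simp add: field_simps)
    moreover have "s \<le> tan \<beta>"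
      unfolding s_def tan_eq using zero_in_dom_T by (intro cSUP_least ratio_le p) auto
    moreover have "cot \<beta> * \<bar>Im (inn (L f) f)\<bar> \<le> Re (inn (L f) f)" if "f \<in> dom_T l q h" for f
      using Re_ge[OF that] Im_eq[OF that] by (simp add: p_eq mult.assoc)
    moreover have "0 \<le> Re (inn (L f) f)" if "f \<in> dom_T l q h" for f
      using Re_ge[OF that] p by (meson less_imp_le mult_nonneg_nonneg order_trans zero_le_power2)
    ultimately show "sectorial inn (dom_T l q h) L \<beta>"
      using b unfolding sectorial_def accretive_def s_def ratio_def by auto
  qed
qed

end

section \<open>The Weyl function at the imaginary unit\<close>

context nonneg_half_line begin

lemma ii_not_nonneg_Reals: "\<i> \<notin> \<real>\<^sub>\<ge>\<^sub>0" "- \<i> \<notin> \<real>\<^sub>\<ge>\<^sub>0"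
  by (auto simp: complex_nonneg_Reals_iff)

text \<open>
  For the Weyl solutions \<open>u\<close> at \<open>\<i>\<close> and \<open>v\<close> at \<open>-\<i>\<close>, both \<open>(L v, u)\<close> and \<open>(v, L u)\<close> equal \<open>-\<i> (v,
  u)\<close>. So the boundary terms of Green's identity cancel.
\<close>

lemma weyl_minus_ii: "m_inf (- \<i>) = cnj (m_inf \<i>)"
proof -
  obtain u where u: "u \<in> D" "u l = -1" "D1 u = m_inf \<i>" "AE x in lebesgue_on {l..}. L u x = \<i> * u x"
    using weyl_solution[OF ii_not_nonneg_Reals(1)] by blast
  obtain v where v: "v \<in> D" "v l = -1" "D1 v = m_inf (- \<i>)" "AE x in lebesgue_on {l..}. L v x = - \<i> * v x"
    using weyl_solution[OF ii_not_nonneg_Reals(2)] by blast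
  have "inn (L v) u = - \<i> * inn v u" "inn v (L u) = cnj \<i> * inn v u"
    using inner_L_eigen_left[OF v(1,4) DstarD(1)[OF u(1)]]
      inner_L_eigen_right[OF u(1,4) DstarD(1)[OF v(1)]] by auto
  with green[OF v(1) u(1)] show ?thesis by (simp add: u v)
qed

text \<open>
  Green's identity gives \<open>Im m\<^sub>\<infinity>(\<i>) = - \<parallel>\<psi>\<parallel>\<^sup>2\<close> for the Weyl solution \<open>\<psi>\<close> at \<open>\<i>\<close>. If \<open>\<psi>\<close> had norm
  zero, Green's identity against a function with boundary data \<open>(0, 1)\<close> would contradict \<open>\<psi>(l) =
  -1\<close>.
\<close>

lemma Im_weyl_ii: "Im (m_inf \<i>) < 0"
proof -
  obtain u where u: "u \<in> D" "u l = -1" "D1 u = m_inf \<i>" "AE x in lebesgue_on {l..}. L u x = \<i> * u x"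
    using weyl_solution[OF ii_not_nonneg_Reals(1)] by blast
  have "inn (L u) u = \<i> * inn u u" "inn u (L u) = - \<i> * inn u u"
    using inner_L_eigen_left[OF u(1,4) DstarD(1)[OF u(1)]]
      inner_L_eigen_right[OF u(1,4) DstarD(1)[OF u(1)]] by auto
  with green[OF u(1) u(1)] have "\<i> * inn u u + \<i> * inn u u = cnj (m_inf \<i>) - m_inf \<i>"
    by (simp add: u)
  then have eq: "norm2_L2 l u = - Im (m_inf \<i>)"
    by (simp add: inner_L2_self complex_eq_iff)
  moreover have "norm2_L2 l u \<noteq> 0"
  proof
    assume 0: "norm2_L2 l u = 0"
    obtain C where C: "C \<ge> 0" "\<And>n::real. n \<ge> 1 \<Longrightarrow> \<exists>\<eta>\<in>D. \<eta> l = 0 \<and> D1 \<eta> = 1 \<and>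
       (\<forall>f\<in>L2 l. cmod (inn f \<eta>) \<le> (norm2_L2 l f + C) / n) \<and> cmod (inn (L \<eta>) \<eta>) \<le> C / n"
      using small_cutoffs by blast
    from C(2)[of 1] obtain v where v: "v \<in> D" "v l = 0" "D1 v = 1" by auto
    have "inn (L u) v = 0" "inn u (L v) = 0"
      using inner_L_eigen_left[OF u(1,4) DstarD(1)[OF v(1)]] inner_L2_norm2_0[OF DstarD(1)[OF u(1)] 0]
      by auto
    with green[OF u(1) v(1)] show False by (simp add: u v)
  qed
  ultimately show ?thesis using norm2_L2_nonneg[of l u] by linarith
qed

end

section \<open>The transfer function and the c-entropy\<close>

text \<open>
  For finite and for infinite \<open>\<mu>\<close>, the state-space operator is a perturbation of the differential
  expression by a multiple of one boundary functional, and the channel is a multiple of it too.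
  Only this functional and the scalar \<open>coupling\<close> depend on the case; together they describe the
  rank-one perturbation uniformly.
\<close>

fun boundary_functional :: "real \<Rightarrow> ext_param \<Rightarrow> (real \<Rightarrow> complex) \<Rightarrow> complex" where
  "boundary_functional l (Finite \<mu>) f = complex_of_real \<mu> * f l - deriv1 l f l"
| "boundary_functional l Infinite f = f l"

fun coupling :: "ext_param \<Rightarrow> complex \<Rightarrow> complex" where
  "coupling (Finite \<mu>) h = 1 / (complex_of_real \<mu> - h)"
| "coupling Infinite h = 1"

definition channel_const :: "ext_param \<Rightarrow> complex \<Rightarrow> real" where
  "channel_const \<mu> h = sqrt (Im h) * cmod (coupling \<mu> h)"

lemma schr_state_op_eq:
  "schr_state_op l q \<mu> h y f = inner_L2 l f (diff_expr l q y) -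
     cnj (coupling \<mu> h * (deriv1 l y l - h * y l)) * boundary_functional l \<mu> f"
  by (cases \<mu>) simp_all

lemma schr_channel_eq:
  "schr_channel l \<mu> h c f = cnj c * (complex_of_real (channel_const \<mu> h) * boundary_functional l \<mu> f)"
  by (cases \<mu>) (simp_all add: channel_const_def norm_divide)

lemma coupling_nonzero:
  assumes "Im h > 0"
  shows "coupling \<mu> h \<noteq> 0"
proof (cases \<mu>)
  case (Finite t)
  have "complex_of_real t \<noteq> h" using assms by auto
  then show ?thesis by (simp add: Finite)
qed simp

lemma channel_const_pos: "Im h > 0 \<Longrightarrow> channel_const \<mu> h > 0"
  by (simp add: channel_const_def coupling_nonzero)

lemma channel_const_square:
  "Im h > 0 \<Longrightarrow> (complex_of_real (channel_const \<mu> h))\<^sup>2 = of_real (Im h) * (coupling \<mu> h * cnj (coupling \<mu> h))"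
  by (simp add: channel_const_def power_mult_distrib flip: complex_norm_square of_real_power)

lemma channel_adj_schr:
  "channel_adj (schr_lsystem l q \<mu> h) f = complex_of_real (channel_const \<mu> h) * boundary_functional l \<mu> f"
  unfolding channel_adj_def
proof (rule the_equality)
  show "\<forall>c. channel (schr_lsystem l q \<mu> h) c f = cnj c * (complex_of_real (channel_const \<mu> h) * boundary_functional l \<mu> f)"
    by (simp add: schr_lsystem_def schr_channel_eq)
next
  fix w assume "\<forall>c. channel (schr_lsystem l q \<mu> h) c f = cnj c * w"
  from this[rule_format, of 1] show "w = complex_of_real (channel_const \<mu> h) * boundary_functional l \<mu> f"
    by (simp add: schr_lsystem_def schr_channel_eq)
qed

text \<open>
  The imaginary part of the boundary perturbation is that of Green's identity plus the square of
  the channel; this is \<open>Im \<bbbA> = K K\<^sup>*\<close> on the diagonal.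
\<close>

lemma dissipation_identity:
  assumes h: "Im h > 0"
  shows "Im (cnj (coupling \<mu> h * (deriv1 l y l - h * y l)) * boundary_functional l \<mu> y) =
    - Im (deriv1 l y l * cnj (y l)) + (channel_const \<mu> h)\<^sup>2 * (cmod (boundary_functional l \<mu> y))\<^sup>2"
proof (cases \<mu>)
  case Infinite
  then show ?thesis using h
    by (simp add: channel_const_def cmod_power2) (simp add: power2_eq_square algebra_simps)
next
  case (Finite t)
  define d where "d = complex_of_real t - h"
  have d: "d \<noteq> 0" using h by (auto simp: d_def complex_eq_iff)
  define a b s where "a = y l" and "b = deriv1 l y l" and "s = complex_of_real t * a - b"
  have bh: "b - h * a = d * a - s" by (simp add: s_def d_def algebra_simps)
  have "cnj (1 / d * (b - h * a)) * s = cnj a * s - (s * cnj s) * (d / (d * cnj d))"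
    unfolding bh using d by (simp add: field_simps)
  also have "\<dots> = cnj a * s - complex_of_real ((cmod s)\<^sup>2) * (d / complex_of_real ((cmod d)\<^sup>2))"
    by (simp only: complex_norm_square)
  finally have "Im (cnj (1 / d * (b - h * a)) * s) = Im (cnj a * s) - (cmod s)\<^sup>2 * (Im d / (cmod d)\<^sup>2)"
    by (simp del: of_real_power)
  moreover have "Im (cnj a * s) = - Im (b * cnj a)"
    by (simp add: s_def algebra_simps)
  moreover have "(channel_const \<mu> h)\<^sup>2 = - Im d / (cmod d)\<^sup>2"
    using h by (simp add: Finite channel_const_def norm_divide power_divide d_def[symmetric]) (simp add: d_def)
  ultimately show ?thesis by (simp add: Finite a_def b_def s_def d_def algebra_simps)
qed

context nonneg_half_line begin

lemma resolvent_value_iff: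
  "is_resolvent_value (schr_lsystem l q \<mu> h) z 1 u \<longleftrightarrow> u \<in> D \<and>
    (\<forall>f\<in>D. inn f (L u) - cnj z * inn f u =
      (cnj (coupling \<mu> h * (D1 u - h * u l)) + complex_of_real (channel_const \<mu> h)) * boundary_functional l \<mu> f)"
  unfolding is_resolvent_value_def schr_lsystem_def
  by (auto simp: schr_state_op_eq schr_channel_eq inner_L2_cmult_right algebra_simps)

lemma boundary_functional_lincomb:
  assumes "u \<in> D" "v \<in> D"
  shows "boundary_functional l \<mu> (\<lambda>x. u x + c * v x) = boundary_functional l \<mu> u + c * boundary_functional l \<mu> v"
  using Dstar_lincomb(3)[OF assms] by (cases \<mu>) (auto simp: algebra_simps)

text \<open>
  The difference \<open>d\<close> of two solutions satisfies the homogeneous equation. Testing it with \<open>d\<close> and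
  taking imaginary parts, the dissipation identity leaves \<open>\<parallel>d\<parallel>\<^sup>2 + |K\<^sup>* d|\<^sup>2 = 0\<close>.
\<close>

lemma resolvent_value_unique:
  assumes h: "Im h > 0"
    and u: "is_resolvent_value (schr_lsystem l q \<mu> h) (- \<i>) 1 u"
    and v: "is_resolvent_value (schr_lsystem l q \<mu> h) (- \<i>) 1 v"
  shows "boundary_functional l \<mu> u = boundary_functional l \<mu> v"
proof -
  have uD: "u \<in> D" and vD: "v \<in> D" using u v by (auto simp: resolvent_value_iff)
  define d where "d = (\<lambda>x. u x + (- 1) * v x)"
  let ?k = "channel_const \<mu> h" and ?s = "boundary_functional l \<mu> d"
  have dD: "d \<in> D" and d1: "D1 d = D1 u + (- 1) * D1 v"
    using Dstar_lincomb(1,3)[OF uD vD, of "-1"] by (auto simp: d_def)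
  have L2: "u \<in> L2 l" "v \<in> L2 l" "L u \<in> L2 l" "L v \<in> L2 l" "d \<in> L2 l" "L d \<in> L2 l"
    using uD vD dD by (auto intro: DstarD)
  have "inn d (L d) = cnj (inn (L d) d)" by (rule inner_L2_cnj)
  also have "inn (L d) d = inn (L u) d + (- 1) * inn (L v) d"
    unfolding d_def by (rule inner_diff_expr_lincomb_left[OF uD vD]) (use L2 in \<open>simp add: d_def\<close>)
  also have "cnj \<dots> = inn d (L u) - inn d (L v)"
    by (simp add: inner_L2_cnj[of l d "L u"] inner_L2_cnj[of l d "L v"])
  finally have Ld: "inn d (L d) = inn d (L u) - inn d (L v)" .
  have dd: "inn d d = inn d u - inn d v"
    using inner_lincomb_right[OF L2(1,2,5), of "- 1"] by (simp add: d_def)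
  have eqs: "inn d (L u) - cnj (- \<i>) * inn d u =
      (cnj (coupling \<mu> h * (D1 u - h * u l)) + complex_of_real ?k) * ?s"
    "inn d (L v) - cnj (- \<i>) * inn d v =
      (cnj (coupling \<mu> h * (D1 v - h * v l)) + complex_of_real ?k) * ?s"
    using u v dD by (auto simp: resolvent_value_iff)
  have cd: "cnj (coupling \<mu> h * (D1 d - h * d l)) =
      cnj (coupling \<mu> h * (D1 u - h * u l)) - cnj (coupling \<mu> h * (D1 v - h * v l))"
    unfolding d1 by (simp add: d_def algebra_simps)
  have "(x - y) * ?s = (x + of_real ?k) * ?s - (y + of_real ?k) * ?s" for x y
    by (simp add: algebra_simps)
  then have "cnj (coupling \<mu> h * (D1 d - h * d l)) * ?s =
      (inn d (L u) - cnj (- \<i>) * inn d u) - (inn d (L v) - cnj (- \<i>) * inn d v)"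
    unfolding cd eqs .
  then have "cnj (coupling \<mu> h * (D1 d - h * d l)) * ?s = inn d (L d) - \<i> * inn d d"
    unfolding Ld dd by (simp add: algebra_simps)
  then have "Im (inn d (L d)) - norm2_L2 l d = - Im (D1 d * cnj (d l)) + ?k\<^sup>2 * (cmod ?s)\<^sup>2"
    using dissipation_identity[OF h, of \<mu> l d] by (simp add: inner_L2_self)
  moreover have "Im (inn d (L d)) = - Im (D1 d * cnj (d l))"
  proof -
    have "Im (inn (L d) d - inn d (L d)) = Im (D1 d * cnj (d l) - d l * cnj (D1 d))"
      using green[OF dD dD] by simp
    then show ?thesis using inner_L2_cnj[of l "L d" d] by (simp add: algebra_simps)
  qed
  ultimately have "?k\<^sup>2 * (cmod ?s)\<^sup>2 = - norm2_L2 l d" by linarith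
  moreover have "0 \<le> ?k\<^sup>2 * (cmod ?s)\<^sup>2" by simp
  ultimately have "?k\<^sup>2 * (cmod ?s)\<^sup>2 = 0" using norm2_L2_nonneg[of l d] by linarith
  then have "?s = 0" using channel_const_pos[OF h, of \<mu>] by simp
  then show ?thesis using boundary_functional_lincomb[OF uD vD, of \<mu> "- 1"] by (simp add: d_def)
qed

text \<open>
  The resolvent equation is solved by \<open>\<alpha> \<psi>\<close>, with \<open>\<psi>\<close> the Weyl solution at \<open>-\<i>\<close> and \<open>\<alpha>\<close> chosen so
  that the boundary terms match. The remaining factor \<open>(\<mu> - h) / (\<mu> - cnj h)\<close> has modulus one.
\<close>

lemma transfer_minus_ii:
  assumes h: "Im h > 0"
  shows "cmod (transfer (schr_lsystem l q \<mu> h) (- \<i>)) = cmod (m_inf \<i> + h) / cmod (m_inf \<i> + cnj h)"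
proof -
  let ?\<Theta> = "schr_lsystem l q \<mu> h" and ?k = "complex_of_real (channel_const \<mu> h)"
  define M where "M = m_inf (- \<i>)"
  define \<gamma> where "\<gamma> = coupling \<mu> h"
  have M: "Im M > 0" using Im_weyl_ii by (simp add: M_def weyl_minus_ii)
  then have Mh: "M + h \<noteq> 0" using h by (auto simp: complex_eq_iff)
  have \<gamma>: "\<gamma> \<noteq> 0" using coupling_nonzero[OF h] by (simp add: \<gamma>_def)
  obtain \<psi> where \<psi>: "\<psi> \<in> D" "\<psi> l = -1" "D1 \<psi> = M" "AE x in lebesgue_on {l..}. L \<psi> x = - \<i> * \<psi> x"
    unfolding M_def using weyl_solution[OF ii_not_nonneg_Reals(2)] by blast
  define \<alpha> where "\<alpha> = - ?k / (\<gamma> * (M + h))"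
  \<comment> \<open>this is \<open>\<alpha> \<psi>\<close>, written as a combination of two elements of the domain\<close>
  define u where "u x = \<psi> x + (\<alpha> - 1) * \<psi> x" for x
  have u_eq: "u = (\<lambda>x. \<psi> x + (\<alpha> - 1) * \<psi> x)" by (simp add: u_def[abs_def])
  have u: "u \<in> D" "u l = - \<alpha>" "D1 u = \<alpha> * M" "boundary_functional l \<mu> u = \<alpha> * boundary_functional l \<mu> \<psi>"
    using Dstar_lincomb(1,3)[OF \<psi>(1,1), of "\<alpha> - 1"] boundary_functional_lincomb[OF \<psi>(1,1), of \<mu> "\<alpha> - 1"] \<psi>(2,3)
    by (auto simp: u_eq algebra_simps)
  have ae: "AE x in lebesgue_on {l..}. L u x = - \<i> * u x"
    using Dstar_lincomb(2)[OF \<psi>(1,1), of "\<alpha> - 1"] \<psi>(4) unfolding u_eq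
    by eventually_elim (simp add: algebra_simps)
  have "\<gamma> * (D1 u - h * u l) = \<alpha> * (\<gamma> * (M + h))" unfolding u by (simp add: algebra_simps)
  also have "\<dots> = - ?k" using \<gamma> Mh by (simp add: \<alpha>_def)
  finally have cu: "coupling \<mu> h * (D1 u - h * u l) = - ?k" by (simp add: \<gamma>_def)
  have res: "is_resolvent_value ?\<Theta> (- \<i>) 1 u"
    unfolding resolvent_value_iff cu using u(1) inner_L_eigen_right[OF u(1) ae DstarD(1)] by simp
  have "transfer ?\<Theta> (- \<i>) = 1 - 2 * \<i> * channel_adj ?\<Theta> u"
    unfolding transfer_def
  proof (rule the_equality)
    show "\<exists>v. is_resolvent_value ?\<Theta> (- \<i>) 1 v \<and> 1 - 2 * \<i> * channel_adj ?\<Theta> u = 1 - 2 * \<i> * channel_adj ?\<Theta> v"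
      using res by blast
  next
    fix w assume "\<exists>v. is_resolvent_value ?\<Theta> (- \<i>) 1 v \<and> w = 1 - 2 * \<i> * channel_adj ?\<Theta> v"
    then show "w = 1 - 2 * \<i> * channel_adj ?\<Theta> u"
      using resolvent_value_unique[OF h res] by (auto simp: channel_adj_schr)
  qed
  also have "\<dots> = 1 + 2 * \<i> * (?k\<^sup>2 * boundary_functional l \<mu> \<psi>) / (\<gamma> * (M + h))"
    by (simp add: channel_adj_schr u \<alpha>_def power2_eq_square)
  also have "\<dots> = 1 + (h - cnj h) * (cnj \<gamma> * boundary_functional l \<mu> \<psi>) / (M + h)"
  proof -
    have "2 * \<i> * of_real (Im h) = h - cnj h" by (simp add: complex_eq_iff)
    then have eq: "2 * \<i> * (?k\<^sup>2 * boundary_functional l \<mu> \<psi>) = \<gamma> * ((h - cnj h) * (cnj \<gamma> * boundary_functional l \<mu> \<psi>))"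
      unfolding channel_const_square[OF h] \<gamma>_def[symmetric] by (metis (no_types, lifting) mult.assoc mult.left_commute)
    show ?thesis unfolding eq using \<gamma> by simp
  qed
  finally have w: "transfer ?\<Theta> (- \<i>) = 1 + (h - cnj h) * (cnj \<gamma> * boundary_functional l \<mu> \<psi>) / (M + h)" .
  have "cmod (transfer ?\<Theta> (- \<i>)) = cmod (M + cnj h) / cmod (M + h)"
  proof (cases \<mu>)
    case Infinite
    have "transfer ?\<Theta> (- \<i>) = (M + cnj h) / (M + h)"
      unfolding w using Mh by (simp add: Infinite \<gamma>_def \<psi> field_simps)
    then show ?thesis by (simp add: norm_divide)
  next
    case (Finite t)
    define d where "d = complex_of_real t - h"
    have d: "d \<noteq> 0" using h by (auto simp: d_def complex_eq_iff)
    have "transfer ?\<Theta> (- \<i>) = 1 - (h - cnj h) * (of_real t + M) / (cnj d * (M + h))"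
    proof -
      have b: "boundary_functional l \<mu> \<psi> = - (of_real t + M)" and g: "cnj \<gamma> = 1 / cnj d"
        by (simp_all add: Finite \<psi> \<gamma>_def d_def)
      show ?thesis unfolding w b g by (simp del: minus_add_distrib)
    qed
    also have "\<dots> = (d / cnj d) * ((M + cnj h) / (M + h))"
    proof -
      have "cnj d * (M + h) - (h - cnj h) * (of_real t + M) = d * (M + cnj h)"
        by (simp add: d_def algebra_simps)
      moreover have "1 = (cnj d * (M + h)) / (cnj d * (M + h))" using d Mh by simp
      ultimately show ?thesis by (metis diff_divide_distrib times_divide_times_eq)
    qed
    finally show ?thesis using d by (simp add: norm_mult norm_divide)
  qed
  also have "cmod (M + cnj h) = cmod (m_inf \<i> + h)"
    using complex_mod_cnj[of "m_inf \<i> + h"] by (simp add: M_def weyl_minus_ii)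
  also have "cmod (M + h) = cmod (m_inf \<i> + cnj h)"
    using complex_mod_cnj[of "m_inf \<i> + cnj h"] by (simp add: M_def weyl_minus_ii)
  finally show ?thesis .
qed

lemma c_entropy_iff:
  assumes h: "Im h > 0"
  shows "c_entropy (schr_lsystem l q \<mu> h) = ereal S \<longleftrightarrow>
    cmod (m_inf \<i> + h) = exp (- S) * cmod (m_inf \<i> + cnj h)"
proof -
  have pos: "cmod (m_inf \<i> + cnj h) > 0"
    using h Im_weyl_ii by (auto simp: complex_eq_iff)
  let ?w = "transfer (schr_lsystem l q \<mu> h) (- \<i>)"
  have w: "cmod ?w = cmod (m_inf \<i> + h) / cmod (m_inf \<i> + cnj h)" by (rule transfer_minus_ii[OF h])
  have "c_entropy (schr_lsystem l q \<mu> h) = ereal S \<longleftrightarrow> ?w \<noteq> 0 \<and> ln (cmod ?w) = - S"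
    by (auto simp: c_entropy_def)
  also have "\<dots> \<longleftrightarrow> cmod ?w = exp (- S)"
    by (metis exp_gt_zero exp_ln ln_exp norm_eq_zero order_less_irrefl zero_less_norm_iff)
  also have "\<dots> \<longleftrightarrow> cmod (m_inf \<i> + h) = exp (- S) * cmod (m_inf \<i> + cnj h)"
    unfolding w using pos by (simp add: field_simps)
  finally show ?thesis .
qed

end

section \<open>The extremal dissipation coefficient\<close>

text \<open>
  Squaring turns the entropy condition into the equation of a circle of Apollonius (a line if \<open>S =
  0\<close>) for \<open>x + \<i> y\<close>. The factor \<open>sinh S\<close> is not divided out, so that \<open>S\<close> may have any sign.
\<close>

lemma entropy_circle:
  fixes A B S x y :: real
  shows "cmod (Complex A (- B) + Complex x y) = exp (- S) * cmod (Complex A (- B) + cnj (Complex x y)) \<longleftrightarrow>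
    ((A + x)\<^sup>2 + y\<^sup>2 + B\<^sup>2) * sinh S = 2 * B * y * cosh S"
proof -
  define X where "X = (A + x)\<^sup>2 + y\<^sup>2 + B\<^sup>2"
  have n: "(cmod (Complex A (- B) + Complex x y))\<^sup>2 = X - 2 * B * y"
    "(cmod (Complex A (- B) + cnj (Complex x y)))\<^sup>2 = X + 2 * B * y"
    by (simp_all add: cmod_power2 X_def) (simp_all add: power2_eq_square algebra_simps)
  have "cmod (Complex A (- B) + Complex x y) = exp (- S) * cmod (Complex A (- B) + cnj (Complex x y)) \<longleftrightarrow>
    (cmod (Complex A (- B) + Complex x y))\<^sup>2 = (exp (- S) * cmod (Complex A (- B) + cnj (Complex x y)))\<^sup>2"
    by (rule power2_eq_iff_nonneg[symmetric]) auto
  also have "\<dots> \<longleftrightarrow> X - 2 * B * y = (exp (- S))\<^sup>2 * (X + 2 * B * y)"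
    unfolding power_mult_distrib n ..
  also have "\<dots> \<longleftrightarrow> exp S * (X - 2 * B * y) = exp S * ((exp (- S))\<^sup>2 * (X + 2 * B * y))"
    by simp
  also have "exp S * ((exp (- S))\<^sup>2 * (X + 2 * B * y)) = exp (- S) * (X + 2 * B * y)"
    by (simp add: power2_eq_square exp_minus)
  also have "exp S * (X - 2 * B * y) = exp (- S) * (X + 2 * B * y) \<longleftrightarrow> X * sinh S = 2 * B * y * cosh S"
  proof -
    have "X * sinh S - 2 * B * y * cosh S = (exp S * (X - 2 * B * y) - exp (- S) * (X + 2 * B * y)) / 2"
      by (simp add: sinh_field_def cosh_field_def field_simps)
    then show ?thesis by auto
  qed
  finally show ?thesis unfolding X_def .
qed

text \<open>
  The existence of one positive root makes the discriminant nonnegative and forces \<open>p < 0\<close>; as the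
  product of the roots is positive, so is the smaller root.
\<close>

lemma smaller_root_of_quadratic:
  fixes s p D y :: real
  assumes s: "s > 0" and D: "D > 0" and y: "y > 0" and eq: "y\<^sup>2 / s + 2 * p * y + D = 0"
  defines "d \<equiv> s * (- p - sqrt (p\<^sup>2 - D / s))"
  shows "0 < d" "d \<le> y" "d\<^sup>2 / s + 2 * p * d + D = 0"
proof -
  define r where "r = sqrt (p\<^sup>2 - D / s)"
  have sq: "(y / s + p)\<^sup>2 = p\<^sup>2 - D / s"
  proof -
    have "(y / s + p)\<^sup>2 = (y\<^sup>2 / s + 2 * p * y + D) / s + (p\<^sup>2 - D / s)"
      using s by (simp add: power2_eq_square field_simps)
    then show ?thesis unfolding eq by simp
  qed
  have r_abs: "r = \<bar>y / s + p\<bar>" unfolding r_def sq[symmetric] by simp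
  have r2: "r\<^sup>2 = p\<^sup>2 - D / s" unfolding r_abs using sq by simp
  have "2 * p * y < 0"
  proof -
    have "0 \<le> y\<^sup>2 / s" using s by simp
    then show ?thesis using eq D by linarith
  qed
  then have p: "p < 0" using y by (simp add: mult_less_0_iff)
  have "r\<^sup>2 < (- p)\<^sup>2" unfolding r2 using s D by simp
  then have "r < - p" by (rule power2_less_imp_less) (use p in simp)
  then show "0 < d" using s by (simp add: d_def r_def)
  have "- p - r \<le> y / s" using r_abs by linarith
  then have "s * (- p - r) \<le> s * (y / s)" using s by (intro mult_left_mono) auto
  then show "d \<le> y" using s by (simp add: d_def r_def)
  have "d\<^sup>2 / s + 2 * p * d + D = s * (r\<^sup>2 - (p\<^sup>2 - D / s))"
    using s unfolding d_def r_def[symmetric] by (simp add: power2_eq_square field_simps)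
  then show "d\<^sup>2 / s + 2 * p * d + D = 0" using r2 by simp
qed

theorem theorem27:
  fixes l m S \<beta> A B D E D_min :: real
    and q :: "real \<Rightarrow> real"
    and m_inf :: "complex \<Rightarrow> complex"
    and \<mu>\<^sub>0 :: ext_param
    and h\<^sub>0 :: complex
  assumes "locally_summable l q"
    and "deficiency_indices_1_1 l q"
    and "nonneg_min_op l q"
    and "is_weyl_function l q m_inf"
    and "((\<lambda>x::real. m_inf (complex_of_real x)) \<longlongrightarrow> complex_of_real m) (at_left 0)"
    and "admissible l q S \<beta> \<mu>\<^sub>0 h\<^sub>0"
    and "A = Re (m_inf \<i>)"
    and "B = - Im (m_inf \<i>)"
    and "E = A - m"
    and "D = E\<^sup>2 + B\<^sup>2"
    and "D_min = min_dissipation B D E \<beta> S"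
  shows "(\<forall>\<mu> h. admissible l q S \<beta> \<mu> h \<longrightarrow> D_min \<le> dissipation_coeff h) \<and>
         (\<forall>\<mu> h. admissible l q S \<beta> \<mu> h \<and> dissipation_coeff h = D_min \<longleftrightarrow>
                h = Complex (cot \<beta> * D_min - m) D_min)"
proof -
  interpret nonneg_half_line_limit l q m_inf m
    by unfold_locales (use assms in auto)
  have B: "B > 0" using Im_weyl_ii assms(8) by simp
  have m_i: "m_inf \<i> = Complex A (- B)" using assms(7,8) by (simp add: complex_eq_iff)
  have D: "D > 0" using B assms(10) by (simp add: add_nonneg_pos)
  define s where "s = (sin \<beta>)\<^sup>2"
  define p where "p = E * cot \<beta> - B * coth S"
  \<comment> \<open>the two constraints on \<open>h\<close>, both independent of \<open>\<mu>\<close>\<close>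
  have adm: "admissible l q S \<beta> \<mu> h \<longleftrightarrow> Im h > 0 \<and> 0 < \<beta> \<and> \<beta> < pi / 2 \<and> Re h = cot \<beta> * Im h - m \<and>
      ((E + cot \<beta> * Im h)\<^sup>2 + (Im h)\<^sup>2 + B\<^sup>2) * sinh S = 2 * B * Im h * cosh S" for \<mu> h
  proof (cases "Im h > 0")
    case True
    have "c_entropy (schr_lsystem l q \<mu> h) = ereal S \<longleftrightarrow>
      ((A + Re h)\<^sup>2 + (Im h)\<^sup>2 + B\<^sup>2) * sinh S = 2 * B * Im h * cosh S"
      using entropy_circle[of A B "Re h" "Im h" S] unfolding c_entropy_iff[OF True] m_i by simp
    then show ?thesis
      using True sectorial_iff[OF True, of \<beta>] assms(9)
      by (auto simp: admissible_def schr_lsystem_def algebra_simps)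
  qed (auto simp: admissible_def)
  from assms(6)[unfolded adm] have h0: "Im h\<^sub>0 > 0" "0 < \<beta>" "\<beta> < pi / 2"
    "((E + cot \<beta> * Im h\<^sub>0)\<^sup>2 + (Im h\<^sub>0)\<^sup>2 + B\<^sup>2) * sinh S = 2 * B * Im h\<^sub>0 * cosh S" by auto
  \<comment> \<open>the given admissible \<open>h\<^sub>0\<close> forces positive entropy, so that dividing by \<open>sinh S\<close> is harmless\<close>
  have S: "sinh S > 0"
  proof -
    have "0 < 2 * B * Im h\<^sub>0 * cosh S" using B h0 by simp
    then have "0 < ((E + cot \<beta> * Im h\<^sub>0)\<^sup>2 + (Im h\<^sub>0)\<^sup>2 + B\<^sup>2) * sinh S" using h0(4) by simp
    moreover have "0 < (E + cot \<beta> * Im h\<^sub>0)\<^sup>2 + (Im h\<^sub>0)\<^sup>2 + B\<^sup>2" using B by (simp add: add_nonneg_pos)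
    ultimately show ?thesis by (simp add: zero_less_mult_iff)
  qed
  have sin: "sin \<beta> > 0" using h0 by (intro sin_gt_zero) auto
  then have s: "s > 0" by (simp add: s_def)
  have cot: "1 + (cot \<beta>)\<^sup>2 = 1 / s"
    using sin sin_cos_squared_add[of \<beta>] by (simp add: s_def cot_def field_simps)
  \<comment> \<open>on the half-line given by the angle, the circle becomes a quadratic equation in the ordinate\<close>
  have quad: "((E + cot \<beta> * y)\<^sup>2 + y\<^sup>2 + B\<^sup>2) * sinh S = 2 * B * y * cosh S \<longleftrightarrow>
      y\<^sup>2 / s + 2 * p * y + D = 0" for y
  proof -
    have "(E + cot \<beta> * y)\<^sup>2 + y\<^sup>2 + B\<^sup>2 - 2 * B * y * coth S = (1 + (cot \<beta>)\<^sup>2) * y\<^sup>2 + 2 * p * y + D"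
      by (simp add: p_def assms(10) power2_eq_square algebra_simps)
    then have "((E + cot \<beta> * y)\<^sup>2 + y\<^sup>2 + B\<^sup>2) - 2 * B * y * (cosh S / sinh S) = y\<^sup>2 / s + 2 * p * y + D"
      unfolding cot coth_def by simp
    moreover have "((E + cot \<beta> * y)\<^sup>2 + y\<^sup>2 + B\<^sup>2) * sinh S = 2 * B * y * cosh S \<longleftrightarrow>
      ((E + cot \<beta> * y)\<^sup>2 + y\<^sup>2 + B\<^sup>2) - 2 * B * y * (cosh S / sinh S) = 0"
      using S by (simp add: field_simps)
    ultimately show ?thesis by simp
  qed
  have Dm: "D_min = s * (- p - sqrt (p\<^sup>2 - D / s))"
    unfolding assms(11) min_dissipation_def s_def p_def by simp
  note root = smaller_root_of_quadratic[OF s D, where p = p, folded Dm]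
  have min_root: "0 < D_min" "D_min\<^sup>2 / s + 2 * p * D_min + D = 0"
    using root(1,3)[OF h0(1)] h0(4) unfolding quad by auto
  show ?thesis
  proof (intro conjI allI impI)
    fix \<mu> h assume "admissible l q S \<beta> \<mu> h"
    then show "D_min \<le> dissipation_coeff h"
      using root(2)[of "Im h"] unfolding adm quad dissipation_coeff_def by blast
  next
    fix \<mu> h
    show "admissible l q S \<beta> \<mu> h \<and> dissipation_coeff h = D_min \<longleftrightarrow> h = Complex (cot \<beta> * D_min - m) D_min"
      unfolding adm quad dissipation_coeff_def complex_eq_iff using min_root h0 by auto
  qed
qed

end
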